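(* Let $n$ be a positive integer and let $0<\alpha<n$. Assume that $u$ is a positive solution of the integral equation $$u(x)=\int_{\mathbb{R}^n}\frac{1}{|x-y|^{n-\alpha}}\,u(y)^{\frac{n+\alpha}{n-\alpha}}\,dy$$ with only one singularity, at a point $x_o\in\mathbb{R}^n$. Then there is a constant $C$ such that $$u(x)\le\frac{C}{|x-x_o|^{\frac{n-\alpha}{2}}}\qquad\text{for all }x\in\mathbb{R}^n\setminus\{x_o\}.$$
   Context: A positive solution is a positive measurable function $u$ for which the integral on the right-hand side is finite and equal to $u(x)$ at every non-singular point $x$. A point is a singularity of $u$ if $u$ is unbounded in every neighbourhood of it. "Only one singularity, at $x_o$" means that $x_o$ is a singularity of $u$, that $u:\mathbb{R}^n\setminus\{x_o\}\to(0,\infty)$ is locally bounded on $\mathbb{R}^n\setminus\{x_o\}$, and that the equation holds at every $x\neq x_o$. *)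

theory Defs
  imports "HOL-Analysis.Analysis"
begin

text \<open>
  A solution is defined only off its singularities, so it is modelled as a total function
  together with its domain \<open>D\<close>; values outside \<open>D\<close> are never used. \<open>D\<close> is required to have
  null complement, so that integrating over \<open>D\<close> is integrating over the whole space.
\<close>

definition singularity :: "(real^'n) set \<Rightarrow> (real^'n \<Rightarrow> real) \<Rightarrow> real^'n \<Rightarrow> bool" where
  "singularity D u x \<longleftrightarrow> (\<forall>U. open U \<and> x \<in> U \<longrightarrow> \<not> bounded (u ` (U \<inter> D)))"

text \<open>
  The integrand takes the value \<open>0\<close> at \<open>y = x\<close> because \<open>1 / 0 = 0\<close>; this is a null set.
  The integrand is nonnegative on \<open>D\<close>, so integrability says that the integral is finite.
\<close>

definition riesz_integrand ::
    "real \<Rightarrow> (real^'n \<Rightarrow> real) \<Rightarrow> real^'n \<Rightarrow> real^'n \<Rightarrow> real" where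
  "riesz_integrand \<alpha> u x y =
     1 / norm (x - y) powr (real CARD('n) - \<alpha>)
       * u y powr ((real CARD('n) + \<alpha>) / (real CARD('n) - \<alpha>))"

definition positive_solution ::
    "real \<Rightarrow> (real^'n) set \<Rightarrow> (real^'n \<Rightarrow> real) \<Rightarrow> bool" where
  "positive_solution \<alpha> D u \<longleftrightarrow>
     negligible (- D) \<and>
     u \<in> borel_measurable (lebesgue_on D) \<and>
     (\<forall>x\<in>D. 0 < u x) \<and>
     (\<forall>x\<in>D. \<not> singularity D u x \<longrightarrow>
        integrable (lebesgue_on D) (riesz_integrand \<alpha> u x) \<and>
        u x = integral\<^sup>L (lebesgue_on D) (riesz_integrand \<alpha> u x))"

text \<open>
  The second conjunct is local boundedness of \<open>u\<close> on the punctured space; for a positive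
  solution it makes the integral equation hold at every \<open>x \<noteq> xo\<close>.
\<close>

definition only_singularity :: "(real^'n \<Rightarrow> real) \<Rightarrow> real^'n \<Rightarrow> bool" where
  "only_singularity u xo \<longleftrightarrow>
     singularity (- {xo}) u xo \<and> (\<forall>x. x \<noteq> xo \<longrightarrow> \<not> singularity (- {xo}) u x)"

end

theory Submission
  imports Defs
begin

text \<open>
  Write \<open>s = n - \<alpha>\<close> and \<open>p = (n + \<alpha>) / (n - \<alpha>)\<close>. If \<open>u\<close> were radially decreasing around \<open>xo\<close>, the
  bound would be immediate: on the ball of radius \<open>R = norm (x - xo)\<close> around \<open>xo\<close> the kernel is at
  least \<open>(2 * R) powr - s\<close> and \<open>u\<close> is at least \<open>u x\<close>, so the equation gives
  \<open>u x \<ge> c * R powr \<alpha> * u x powr p\<close>, and since \<open>p - 1 = 2 * \<alpha> / s\<close> this says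
  \<open>u x \<le> C * R powr - (s / 2)\<close>. The same computation (\<open>isolated_singularity_bound\<close>) works when
  monotonicity holds up to a constant factor, and this is what is proved:
  \<open>u x \<le> 2 powr (s / 2) * u y\<close> whenever \<open>y\<close> is closer to \<open>xo\<close> than \<open>x\<close>
  (\<open>u_le_closer_to_singularity\<close>).

  The comparison comes from the method of moving spheres. Put the centre of the spheres at the
  origin and the singularity at \<open>z\<close>. For a radius \<open>l < norm z\<close> let
  \<open>v y = (l / norm y) powr s * u (l\<^sup>2 * y / (norm y)\<^sup>2)\<close> be the Kelvin transform of \<open>u\<close>. The exponent
  \<open>p\<close> makes the equation conformally invariant: folding the exterior of the ball \<open>B\<close> of radius
  \<open>l\<close> into \<open>B\<close> gives \<open>u x - v x = \<integral>\<^sub>B (F - G) (u\<^sup>p - v\<^sup>p)\<close>, where \<open>F\<close> is the Riesz kernel and \<open>G < F\<close> its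
  reflection (\<open>kelvin_difference\<close>). The claim is \<open>u \<le> v\<close> on \<open>B\<close> for every \<open>l < norm z\<close>
  (\<open>dominated_all_radii\<close>).

  The singularity lies outside \<open>B\<close>, so \<open>u\<close> is bounded on \<open>B\<close> and \<open>u - v\<close> has a finite supremum
  there. If the set where \<open>u > v\<close> has small measure, the integral of \<open>F\<close> over it is small, and the
  identity shows that the supremum, if positive, is at most half of itself; hence \<open>u \<le> v\<close>
  (\<open>dominated_if_small_bad_set\<close>). This starts the argument at small radii. It also continues it
  past any radius \<open>L < norm z\<close> reached: there \<open>u \<le> v\<close> by continuity, and \<open>u < v\<close> since equality at
  one point would force \<open>u = v\<close> almost everywhere on \<open>B\<close>, whereas \<open>v\<close> inherits the
  unboundedness of \<open>u\<close> at \<open>z\<close> (\<open>dominated_imp_strict\<close>); so for radii slightly larger than \<open>L\<close> the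
  set where \<open>u > v\<close> is small again (\<open>bad_set_vanishes\<close>). Sup-norm estimates suffice throughout,
  because the comparison is made inside the ball, where \<open>u\<close> is bounded.

  The two-point comparison is the case of the sphere with centre \<open>2 * x - y\<close> and radius
  \<open>sqrt 2 * norm (x - y)\<close>, whose inversion exchanges \<open>x\<close> and \<open>y\<close>.
\<close>

section \<open>Inversion in a sphere\<close>

definition sphere_inversion :: "real \<Rightarrow> 'a::euclidean_space \<Rightarrow> 'a" where
  "sphere_inversion l y = (l\<^sup>2 / (norm y)\<^sup>2) *\<^sub>R y"

lemma sphere_inversion_0 [simp]: "sphere_inversion l 0 = 0"
  by (simp add: sphere_inversion_def)

lemma sphere_inversion_eq_0_iff [simp]: "0 < l \<Longrightarrow> sphere_inversion l y = 0 \<longleftrightarrow> y = 0"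
  by (auto simp: sphere_inversion_def)

lemma norm_sphere_inversion: "norm (sphere_inversion l y) = l\<^sup>2 / norm y"
  by (simp add: sphere_inversion_def power2_eq_square)

lemma sphere_inversion_involution [simp]: "0 < l \<Longrightarrow> sphere_inversion l (sphere_inversion l y) = y"
  by (cases "y = 0")
     (simp_all add: sphere_inversion_def norm_sphere_inversion[unfolded sphere_inversion_def]
        power2_eq_square field_simps)

lemma norm_sphere_inversion_diff_sq:
  fixes y e :: "'a::euclidean_space"
  assumes "e \<noteq> 0"
  shows "(norm e * norm (y - sphere_inversion l e))\<^sup>2
           = (norm y)\<^sup>2 * (norm e)\<^sup>2 - 2 * l\<^sup>2 * (y \<bullet> e) + l ^ 4"
proof -
  have ee: "e \<bullet> e \<noteq> 0" using assms by simp
  have "(norm e * norm (y - sphere_inversion l e))\<^sup>2 =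
      (e \<bullet> e) * ((y - (l\<^sup>2 / (e \<bullet> e)) *\<^sub>R e) \<bullet> (y - (l\<^sup>2 / (e \<bullet> e)) *\<^sub>R e))"
    by (simp add: power_mult_distrib power2_norm_eq_inner sphere_inversion_def)
  also have "\<dots> = (y \<bullet> y) * (e \<bullet> e) - 2 * l\<^sup>2 * (y \<bullet> e) + l ^ 4"
    using ee by (simp add: inner_diff_left inner_diff_right inner_commute field_simps power2_eq_square power4_eq_xxxx)
  finally show ?thesis by (simp add: power2_norm_eq_inner)
qed

text \<open>
  The square computed in the preceding lemma is symmetric in \<open>y\<close> and \<open>e\<close>.
\<close>

lemma norm_sphere_inversion_diff_swap:
  fixes y e :: "'a::euclidean_space"
  assumes "y \<noteq> 0" "e \<noteq> 0"
  shows "norm e * norm (y - sphere_inversion l e) = norm y * norm (sphere_inversion l y - e)"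
proof -
  have "(norm e * norm (y - sphere_inversion l e))\<^sup>2 = (norm y * norm (e - sphere_inversion l y))\<^sup>2"
    using assms by (simp add: norm_sphere_inversion_diff_sq inner_commute mult.commute)
  then show ?thesis
    by (simp add: norm_minus_commute)
qed

lemma norm_diff_sphere_inversions:
  fixes y e :: "'a::euclidean_space"
  assumes "y \<noteq> 0" "e \<noteq> 0" "0 < l"
  shows "norm y * norm e * norm (sphere_inversion l y - sphere_inversion l e) = l\<^sup>2 * norm (y - e)"
proof -
  have "norm e * norm (sphere_inversion l y - sphere_inversion l e)
        = norm (sphere_inversion l y) * norm (y - e)"
    using norm_sphere_inversion_diff_swap[of "sphere_inversion l y" e l] assms by simp
  then show ?thesis
    using assms by (simp add: norm_sphere_inversion field_simps)
qed

lemma continuous_on_sphere_inversion: "continuous_on (- {0}) (sphere_inversion l)"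
  unfolding sphere_inversion_def by (intro continuous_intros) auto

lemma borel_measurable_sphere_inversion [measurable]:
  "sphere_inversion l \<in> borel_measurable (borel :: 'a::euclidean_space measure)"
  unfolding sphere_inversion_def by measurable

text \<open>
  Inversion maps balls that stay away from the origin to balls, with an explicit radius. This
  replaces the determinant of the derivative in the change of variables below.
\<close>

lemma sphere_inversion_ball:
  fixes c :: "'a::euclidean_space"
  assumes "0 < l" "0 < r" "r < norm c"
  shows "sphere_inversion l ` ball c r =
    ball ((l\<^sup>2 / ((norm c)\<^sup>2 - r\<^sup>2)) *\<^sub>R c) (l\<^sup>2 / ((norm c)\<^sup>2 - r\<^sup>2) * r)" (is "_ = ball (?m *\<^sub>R c) (?m * r)")
proof -
  have pos: "0 < (norm c)\<^sup>2 - r\<^sup>2"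
    using assms by (simp add: power_strict_mono)
  have m: "0 < ?m" using pos assms by simp
  have sq: "x\<^sup>2 < t\<^sup>2 \<longleftrightarrow> x < t" if "0 \<le> x" "0 < t" for x t :: real
    using that abs_le_square_iff[of t x] by (simp flip: not_le)
  \<comment> \<open>Multiplied out, both membership conditions say that the same quadratic in y is negative.\<close>
  have key: "sphere_inversion l y \<in> ball (?m *\<^sub>R c) (?m * r) \<longleftrightarrow> y \<in> ball c r" if "y \<noteq> 0" for y
  proof -
    have yy: "0 < (y \<bullet> y)" using that by simp
    define d where "d = (norm c)\<^sup>2 - r\<^sup>2"
    have d0: "d > 0" and cc: "c \<bullet> c = d + r\<^sup>2" using pos by (auto simp: d_def power2_norm_eq_inner)
    have "sphere_inversion l y \<in> ball (?m *\<^sub>R c) (?m * r)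
        \<longleftrightarrow> (norm (?m *\<^sub>R c - sphere_inversion l y))\<^sup>2 < (?m * r)\<^sup>2"
      unfolding mem_ball dist_norm by (rule sq[symmetric]) (use m assms in \<open>simp_all only: norm_ge_zero mult_pos_pos\<close>)
    also have "\<dots> \<longleftrightarrow> (l\<^sup>2 / d)\<^sup>2 * (c \<bullet> c) - 2 * (l\<^sup>2 / d) * (l\<^sup>2 / (y \<bullet> y)) * (c \<bullet> y) + (l\<^sup>2)\<^sup>2 / (y \<bullet> y)
           < (l\<^sup>2 / d)\<^sup>2 * r\<^sup>2"
    proof -
      have "(norm (m *\<^sub>R c - k *\<^sub>R y))\<^sup>2 = m\<^sup>2 * (c \<bullet> c) - 2 * m * k * (c \<bullet> y) + k\<^sup>2 * (y \<bullet> y)" for m k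
        by (simp only: power2_norm_eq_inner)
           (simp add: inner_diff_left inner_diff_right inner_commute power2_eq_square algebra_simps)
      note * = this[of "l\<^sup>2 / d" "l\<^sup>2 / (y \<bullet> y)"]
      have "(l\<^sup>2 / (y \<bullet> y))\<^sup>2 * (y \<bullet> y) = (l\<^sup>2)\<^sup>2 / (y \<bullet> y)"
        using yy by (simp add: power2_eq_square)
      then show ?thesis
        unfolding d_def[symmetric] sphere_inversion_def power_mult_distrib
          power2_norm_eq_inner[of y] * by simp
    qed
    also have "(l\<^sup>2 / d)\<^sup>2 * (c \<bullet> c) - 2 * (l\<^sup>2 / d) * (l\<^sup>2 / (y \<bullet> y)) * (c \<bullet> y) + (l\<^sup>2)\<^sup>2 / (y \<bullet> y)
           = (l\<^sup>2 / d)\<^sup>2 * r\<^sup>2 + (l\<^sup>2)\<^sup>2 / (d * (y \<bullet> y)) * ((y \<bullet> y) - 2 * (c \<bullet> y) + d)"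
      using yy d0 unfolding cc by (simp add: field_simps power2_eq_square)
    also have "\<dots> < (l\<^sup>2 / d)\<^sup>2 * r\<^sup>2 \<longleftrightarrow> (y \<bullet> y) - 2 * (c \<bullet> y) + d < 0"
    proof -
      have "0 < (l\<^sup>2)\<^sup>2 / (d * (y \<bullet> y))" using yy d0 assms by simp
      then show ?thesis by (simp only: add_less_same_cancel1 mult_less_0_iff) auto
    qed
    also have "\<dots> \<longleftrightarrow> (norm (c - y))\<^sup>2 < r\<^sup>2"
      using cc by (simp add: power2_norm_eq_inner inner_diff_left inner_diff_right inner_commute) auto
    also have "\<dots> \<longleftrightarrow> y \<in> ball c r"
      using assms sq[of "norm (c - y)" r] by (simp add: dist_norm)
    finally show ?thesis .
  qed
  have 0: "0 \<notin> ball c r" using assms by simp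
  have 1: "0 \<notin> ball (?m *\<^sub>R c) (?m * r)" 
  proof -
    have "?m * r < ?m * norm c" using m assms by (intro mult_strict_left_mono)
    also have "\<dots> = dist (?m *\<^sub>R c) 0" using m by (simp only: dist_norm norm_scaleR diff_zero abs_of_pos)
    finally show ?thesis by (simp only: mem_ball not_less less_imp_le simp_thms)
  qed
  show ?thesis
  proof (intro equalityI subsetI)
    fix x assume "x \<in> sphere_inversion l ` ball c r"
    then obtain y where y: "x = sphere_inversion l y" "y \<in> ball c r" by blast
    with 0 have "y \<noteq> 0" by metis
    with key y show "x \<in> ball (?m *\<^sub>R c) (?m * r)" by blast
  next
    fix x assume x: "x \<in> ball (?m *\<^sub>R c) (?m * r)"
    with 1 have "x \<noteq> 0" by metis
    then have "sphere_inversion l x \<in> ball c r"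
      using key[of "sphere_inversion l x"] x assms by simp
    then show "x \<in> sphere_inversion l ` ball c r"
      using assms by (metis imageI sphere_inversion_involution)
  qed
qed

section \<open>Change of variables under inversion\<close>

text \<open>
  On a small ball the Jacobian \<open>(l / norm y) ^ (2 * DIM('a))\<close> is nearly constant, and it nearly
  equals the ratio between the volumes of the image ball and of the ball itself, with an error
  factor that tends to 1 with the radius.
\<close>

lemma emeasure_sphere_inversion_ball_approx:
  fixes c :: "'a::euclidean_space"
  assumes l: "0 < l" and q: "1 < q" and c: "c \<noteq> 0"
  shows "\<exists>d>0. \<forall>r. 0 < r \<longrightarrow> r < d \<longrightarrow>
     emeasure lborel (sphere_inversion l ` ball c r)
        \<le> ennreal q * (\<integral>\<^sup>+y\<in>ball c r. ennreal ((l / norm y) ^ (2 * DIM('a))) \<partial>lborel) \<and>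
     (\<integral>\<^sup>+y\<in>ball c r. ennreal ((l / norm y) ^ (2 * DIM('a))) \<partial>lborel)
        \<le> ennreal q * emeasure lborel (sphere_inversion l ` ball c r)"
proof -
  let ?N = "DIM('a)" and ?J = "\<lambda>y::'a. (l / norm y) ^ (2 * DIM('a))"
  have "((\<lambda>r. ((norm c + r) / (norm c - r)) ^ ?N) \<longlongrightarrow> ((norm c + 0) / (norm c - 0)) ^ ?N) (at_right 0)"
    using c by (intro tendsto_intros) auto
  then have "\<forall>\<^sub>F r in at_right 0. ((norm c + r) / (norm c - r)) ^ ?N < q"
    using q c by (intro order_tendstoD) auto
  then obtain d0 where d0: "d0 > 0" "\<And>r. 0 < r \<Longrightarrow> r < d0 \<Longrightarrow> ((norm c + r) / (norm c - r)) ^ ?N < q"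
    by (auto simp: eventually_at_right_field)
  show ?thesis
  proof (intro exI[of _ "min d0 (norm c)"] conjI allI impI)
    show "0 < min d0 (norm c)" using d0 c by simp
    fix r :: real assume r: "0 < r" "r < min d0 (norm c)"
    let ?B = "ball c r"
    define m where "m = (l\<^sup>2 / ((norm c)\<^sup>2 - r\<^sup>2)) ^ ?N"
    have rc: "r < norm c" using r by simp
    have D: "(norm c)\<^sup>2 - r\<^sup>2 = (norm c - r) * (norm c + r)"
      by (simp add: power2_eq_square algebra_simps)
    have Dpos: "0 < (norm c)\<^sup>2 - r\<^sup>2" unfolding D using r rc by simp
    have qr: "((norm c + r) / (norm c - r)) ^ ?N \<le> q" using d0(2)[of r] r by simp
    have m0: "0 \<le> m" using Dpos by (simp add: m_def)
    have comp: "m \<le> q * ?J y \<and> ?J y \<le> q * m" if "y \<in> ?B" for y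
    proof -
      have ny: "norm y \<le> norm c + r" "norm c - r \<le> norm y"
        using that norm_triangle_ineq2[of c y] norm_triangle_ineq2[of y c]
        by (auto simp: dist_norm norm_minus_commute)
      have y0: "0 < norm y" using ny rc by linarith
      have J: "?J y = (l\<^sup>2 / (norm y)\<^sup>2) ^ ?N"
        by (simp add: power_mult power_divide)
      have A: "l\<^sup>2 / ((norm c)\<^sup>2 - r\<^sup>2) \<le> (norm c + r) / (norm c - r) * (l\<^sup>2 / (norm y)\<^sup>2)"
      proof -
        have "(norm y)\<^sup>2 \<le> (norm c + r)\<^sup>2" using ny y0 by (intro power_mono) auto
        then have "1 / (norm c + r) \<le> (norm c + r) / (norm y)\<^sup>2"
          using y0 r rc by (simp add: field_simps power2_eq_square)
        then have "l\<^sup>2 / (norm c - r) * (1 / (norm c + r)) \<le> l\<^sup>2 / (norm c - r) * ((norm c + r) / (norm y)\<^sup>2)"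
          using rc by (intro mult_left_mono) auto
        then show ?thesis unfolding D by (simp add: mult.commute)
      qed
      have B: "l\<^sup>2 / (norm y)\<^sup>2 \<le> (norm c + r) / (norm c - r) * (l\<^sup>2 / ((norm c)\<^sup>2 - r\<^sup>2))"
      proof -
        have "(norm c - r)\<^sup>2 \<le> (norm y)\<^sup>2" using ny rc by (intro power_mono) auto
        then have "l\<^sup>2 / (norm y)\<^sup>2 \<le> l\<^sup>2 / (norm c - r)\<^sup>2"
          using rc y0 by (intro divide_left_mono) auto
        also have "\<dots> = (norm c + r) / (norm c - r) * (l\<^sup>2 / ((norm c)\<^sup>2 - r\<^sup>2))"
          using r rc unfolding D by (simp add: power2_eq_square)
        finally show ?thesis .
      qed
      have "m \<le> ((norm c + r) / (norm c - r) * (l\<^sup>2 / (norm y)\<^sup>2)) ^ ?N"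
        unfolding m_def by (rule power_mono[OF A]) (use Dpos in simp)
      then have "m \<le> ((norm c + r) / (norm c - r)) ^ ?N * ?J y"
        by (simp only: power_mult_distrib J)
      moreover have "(l\<^sup>2 / (norm y)\<^sup>2) ^ ?N \<le> ((norm c + r) / (norm c - r) * (l\<^sup>2 / ((norm c)\<^sup>2 - r\<^sup>2))) ^ ?N"
        by (rule power_mono[OF B]) simp
      then have "?J y \<le> ((norm c + r) / (norm c - r)) ^ ?N * m"
        by (simp only: power_mult_distrib J m_def)
      moreover have "0 \<le> ?J y" using l by simp
      ultimately show ?thesis
        using mult_right_mono[OF qr, of "?J y"] mult_right_mono[OF qr m0] by linarith
    qed
    have "emeasure lborel (sphere_inversion l ` ?B) =
        ennreal (unit_ball_vol ?N * (l\<^sup>2 / ((norm c)\<^sup>2 - r\<^sup>2) * r) ^ ?N)"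
      using l r rc Dpos by (subst sphere_inversion_ball) (auto intro!: emeasure_ball)
    also have "unit_ball_vol ?N * (l\<^sup>2 / ((norm c)\<^sup>2 - r\<^sup>2) * r) ^ ?N = m * (unit_ball_vol ?N * r ^ ?N)"
      by (simp add: m_def power_mult_distrib power_divide)
    also have "ennreal \<dots> = ennreal m * emeasure lborel ?B"
      using r m0 by (simp add: emeasure_ball ennreal_mult)
    also have "\<dots> = (\<integral>\<^sup>+y\<in>?B. ennreal m \<partial>lborel)"
      by (simp add: nn_integral_cmult_indicator)
    finally have E: "emeasure lborel (sphere_inversion l ` ?B) = (\<integral>\<^sup>+y\<in>?B. ennreal m \<partial>lborel)" .
    have "(\<integral>\<^sup>+y\<in>?B. ennreal m \<partial>lborel) \<le> (\<integral>\<^sup>+y. ennreal q * (ennreal (?J y) * indicator ?B y) \<partial>lborel)"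
      using comp q l by (intro nn_integral_mono)
        (auto simp: indicator_def ennreal_mult[symmetric] simp del: power_mult intro!: ennreal_leI)
    then show "emeasure lborel (sphere_inversion l ` ?B) \<le> ennreal q * (\<integral>\<^sup>+y\<in>?B. ennreal (?J y) \<partial>lborel)"
      unfolding E by (subst (asm) nn_integral_cmult) (measurable, simp)
    have "(\<integral>\<^sup>+y\<in>?B. ennreal (?J y) \<partial>lborel) \<le> (\<integral>\<^sup>+y. ennreal q * (ennreal m * indicator ?B y) \<partial>lborel)"
      using comp q l m0 by (intro nn_integral_mono)
        (auto simp: indicator_def ennreal_mult[symmetric] simp del: power_mult intro!: ennreal_leI)
    then show "(\<integral>\<^sup>+y\<in>?B. ennreal (?J y) \<partial>lborel) \<le> ennreal q * emeasure lborel (sphere_inversion l ` ?B)"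
      unfolding E by (subst (asm) nn_integral_cmult) (measurable, simp)
  qed
qed

lemma ennreal_le_mult_one_interval:
  fixes a b :: ennreal
  assumes "\<And>q::real. 1 < q \<Longrightarrow> a \<le> ennreal q * b"
  shows "a \<le> b"
proof (cases "b = top")
  case False
  then obtain t where t: "b = ennreal t" "0 \<le> t" by (cases b) auto
  have "a \<le> ennreal 2 * b" by (rule assms) simp
  also have "\<dots> < top" using t by (simp add: ennreal_mult_less_top)
  finally obtain w where w: "a = ennreal w" "0 \<le> w" by (cases a) auto
  have le: "w \<le> q * t" if "1 < q" for q
    using assms[OF that] that t w by (simp add: ennreal_mult[symmetric])
  have "w \<le> t"
  proof (rule field_le_mult_one_interval)
    fix x :: real assume x: "0 < x" "x < 1"
    then have "w \<le> 1 / x * t" by (intro le) simp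
    with x show "x * w \<le> t" by (simp add: field_simps)
  qed
  then show ?thesis using t w by simp
qed simp

lemma inj_sphere_inversion: "0 < l \<Longrightarrow> inj (sphere_inversion l)"
  by (metis injI sphere_inversion_involution)

lemma sphere_inversion_image_eq_vimage:
  assumes "0 < l"
  shows "sphere_inversion l ` S = sphere_inversion l -` S"
proof (intro equalityI subsetI)
  fix x assume "x \<in> sphere_inversion l -` S"
  then have "sphere_inversion l (sphere_inversion l x) \<in> sphere_inversion l ` S" by simp
  then show "x \<in> sphere_inversion l ` S" using assms by simp
qed (use assms in auto)

lemma sphere_inversion_image_borel:
  assumes "0 < l" "S \<in> sets borel"
  shows "sphere_inversion l ` (S :: 'a::euclidean_space set) \<in> sets borel"
proof -
  have "sphere_inversion l ` S = sphere_inversion l -` S \<inter> space (borel :: 'a measure)"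
    using sphere_inversion_image_eq_vimage[OF assms(1)] by simp
  also have "\<dots> \<in> sets borel"
    using assms(2) by (intro measurable_sets[OF borel_measurable_sphere_inversion])
  finally show ?thesis .
qed

lemma negligible_sphere_inversion_image:
  fixes S :: "'a::euclidean_space set"
  assumes "negligible S" "0 \<notin> S"
  shows "negligible (sphere_inversion l ` S)"
proof (rule negligible_differentiable_image_negligible[OF order_refl assms(1)])
  have "sphere_inversion l differentiable (at x)" if "x \<noteq> 0" for x :: 'a
  proof -
    have "(\<lambda>y::'a. y \<bullet> y) differentiable (at x)"
      by (rule differentiable_inner[OF differentiable_ident differentiable_ident])
    then have "(\<lambda>y. l\<^sup>2 / (y \<bullet> y)) differentiable (at x)"
      using that by (intro differentiable_divide[OF differentiable_const]) auto
    from differentiable_scaleR[OF this differentiable_ident] show ?thesis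
      by (simp add: sphere_inversion_def[abs_def] power2_norm_eq_inner)
  qed
  then show "sphere_inversion l differentiable_on S"
    unfolding differentiable_on_def using assms(2) by (metis differentiable_at_withinI)
qed

text \<open>
  By Vitali's covering theorem an open set is, up to a null set, a disjoint union of balls so
  small that the preceding estimate holds on each with a factor \<open>q\<close> arbitrarily close to 1.
\<close>

lemma emeasure_sphere_inversion_open:
  fixes T :: "'a::euclidean_space set"
  assumes l: "0 < l" and T: "open T" "0 \<notin> T"
  shows "emeasure lborel (sphere_inversion l ` T) =
     (\<integral>\<^sup>+y\<in>T. ennreal ((l / norm y) ^ (2 * DIM('a))) \<partial>lborel)" (is "?L = ?R")
proof -
  let ?J = "\<lambda>y::'a. ennreal ((l / norm y) ^ (2 * DIM('a)))"
  have approx: "?L \<le> ennreal q * ?R \<and> ?R \<le> ennreal q * ?L" if q: "1 < q" for q :: real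
  proof -
    define K where "K = {(c, r). 0 < r \<and> ball c r \<subseteq> T \<and>
       emeasure lborel (sphere_inversion l ` ball c r) \<le> ennreal q * (\<integral>\<^sup>+y\<in>ball c r. ?J y \<partial>lborel) \<and>
       (\<integral>\<^sup>+y\<in>ball c r. ?J y \<partial>lborel) \<le> ennreal q * emeasure lborel (sphere_inversion l ` ball c r)}"
    obtain C where C: "countable C" "C \<subseteq> K"
      "pairwise (\<lambda>i j. disjnt (ball (fst i) (snd i)) (ball (fst j) (snd j))) C"
      "negligible (T - (\<Union>i\<in>C. ball (fst i) (snd i)))"
    proof (rule Vitali_covering_theorem_balls[of T K fst snd])
      fix x and d :: real assume x: "x \<in> T" and d: "0 < d"
      then have "x \<noteq> 0" using T by auto
      from emeasure_sphere_inversion_ball_approx[OF l q this] obtain d0 where d0: "d0 > 0" and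
        ap: "\<And>r. 0 < r \<Longrightarrow> r < d0 \<Longrightarrow>
          emeasure lborel (sphere_inversion l ` ball x r) \<le> ennreal q * (\<integral>\<^sup>+y\<in>ball x r. ?J y \<partial>lborel) \<and>
          (\<integral>\<^sup>+y\<in>ball x r. ?J y \<partial>lborel) \<le> ennreal q * emeasure lborel (sphere_inversion l ` ball x r)"
        by blast
      obtain e where e: "e > 0" "ball x e \<subseteq> T" using T x by (meson openE)
      define r where "r = min e (min d d0) / 2"
      have r: "0 < r" "r < d" "r < d0" "r \<le> e" using e d d0 by (auto simp: r_def min_def)
      then have "(x, r) \<in> K" using ap[of r] e by (auto simp: K_def)
      with r show "\<exists>i. i \<in> K \<and> x \<in> ball (fst i) (snd i) \<and> snd i < d"
        by (intro exI[of _ "(x, r)"]) auto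
    qed blast
    define B where "B = (\<lambda>i::'a \<times> real. ball (fst i) (snd i))"
    define U where "U = (\<Union>i\<in>C. B i)"
    have BT: "B i \<subseteq> T" if "i \<in> C" for i using that C(2) unfolding K_def B_def by force
    have disj: "disjoint_family_on B C"
      using C(3) unfolding disjoint_family_on_def pairwise_def disjnt_def B_def by blast
    have disj': "disjoint_family_on (\<lambda>i. sphere_inversion l ` B i) C"
      using disj inj_sphere_inversion[OF l] unfolding disjoint_family_on_def
      by (metis image_Int image_empty)
    have UT: "U \<subseteq> T" using BT by (auto simp: U_def)
    have Um[measurable]: "U \<in> sets borel" unfolding U_def B_def by (intro borel_open) auto
    have Tm[measurable]: "T \<in> sets borel" using T by simp
    have neg: "negligible (T - U)" using C(4) by (simp add: U_def B_def)
    have Bm[measurable]: "B i \<in> sets borel" for i by (simp add: B_def)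
    have null: "T - U \<in> null_sets lborel"
      using neg by (simp add: negligible_iff_null_sets null_sets_completion_iff)
    have "sphere_inversion l ` (T - U) \<in> null_sets (completion lborel)"
      using negligible_sphere_inversion_image[OF neg, of l] T by (simp add: negligible_iff_null_sets)
    moreover have "sphere_inversion l ` (T - U) \<in> sets lborel"
      using sphere_inversion_image_borel[OF l, of "T - U"] by simp
    ultimately have null': "sphere_inversion l ` (T - U) \<in> null_sets lborel"
      using null_sets_completion_iff by blast
    have "sphere_inversion l ` T = sphere_inversion l ` U \<union> sphere_inversion l ` (T - U)"
      using UT by blast
    then have "?L = emeasure lborel (sphere_inversion l ` U)"
      using emeasure_Un_null_set[OF _ null'] sphere_inversion_image_borel[OF l Um] by simp
    also have "sphere_inversion l ` U = (\<Union>i\<in>C. sphere_inversion l ` B i)"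
      by (simp add: U_def image_UN)
    also have "emeasure lborel \<dots> = (\<integral>\<^sup>+i. emeasure lborel (sphere_inversion l ` B i) \<partial>count_space C)"
      using sphere_inversion_image_borel[OF l Bm] by (intro emeasure_UN_countable C(1) disj') simp
    finally have L: "?L = (\<integral>\<^sup>+i. emeasure lborel (sphere_inversion l ` B i) \<partial>count_space C)" .
    have dens: "emeasure (density lborel ?J) S = (\<integral>\<^sup>+y\<in>S. ?J y \<partial>lborel)" if "S \<in> sets borel" for S
      using that by (intro emeasure_density) auto
    have nd: "T - U \<in> null_sets (density lborel ?J)"
      using null by (intro absolutely_continuousI_density[unfolded absolutely_continuous_def, THEN subsetD]) auto
    have "?R = emeasure (density lborel ?J) (U \<union> (T - U))"
      using UT dens[OF Tm] by (simp add: Un_absorb1 Un_Diff_cancel)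
    also have "\<dots> = emeasure (density lborel ?J) U"
      by (rule emeasure_Un_null_set[OF _ nd]) simp
    also have "\<dots> = (\<integral>\<^sup>+i. emeasure (density lborel ?J) (B i) \<partial>count_space C)"
      unfolding U_def by (intro emeasure_UN_countable C(1) disj) simp
    finally have R: "?R = (\<integral>\<^sup>+i. emeasure (density lborel ?J) (B i) \<partial>count_space C)" .
    have K: "emeasure lborel (sphere_inversion l ` B i) \<le> ennreal q * emeasure (density lborel ?J) (B i)"
        "emeasure (density lborel ?J) (B i) \<le> ennreal q * emeasure lborel (sphere_inversion l ` B i)" if "i \<in> C" for i
      using that C(2) unfolding dens[OF Bm] by (auto simp: K_def B_def)
    show ?thesis
      unfolding L R using K
      by (auto simp: nn_integral_cmult[symmetric] intro!: nn_integral_mono)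
  qed
  show ?thesis
    by (rule antisym; rule ennreal_le_mult_one_interval; use approx in blast)
qed

text \<open>
  A box may contain the origin, where the inversion is discontinuous. This does no harm: the
  Jacobian vanishes at \<open>0\<close> by the convention for division by zero, and one point is a null set.
\<close>

lemma lborel_eq_distr_sphere_inversion:
  assumes l: "0 < l"
  shows "(lborel :: 'a::euclidean_space measure) =
    distr (density lborel (\<lambda>y. ennreal ((l / norm y) ^ (2 * DIM('a))))) borel (sphere_inversion l)"
    (is "_ = distr ?D borel _")
proof (rule lborel_eqI)
  fix a b :: 'a assume ab: "\<And>i. i \<in> Basis \<Longrightarrow> a \<bullet> i \<le> b \<bullet> i"
  let ?J = "\<lambda>y::'a. ennreal ((l / norm y) ^ (2 * DIM('a)))"
  define T where "T = - {0} \<inter> sphere_inversion l -` (box a b)"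
  have T: "open T" "0 \<notin> T"
    unfolding T_def using continuous_on_sphere_inversion[of l]
    by (auto intro!: continuous_open_preimage open_box simp: open_Compl)
  have imT: "sphere_inversion l ` T = box a b - {0}"
    using l by (auto simp: T_def sphere_inversion_image_eq_vimage)
  have vm: "sphere_inversion l -` (box a b) \<in> sets (borel :: 'a measure)"
    using measurable_sets[OF borel_measurable_sphere_inversion[of l], of "box a b"] by simp
  have "emeasure (distr ?D borel (sphere_inversion l)) (box a b) = emeasure ?D (sphere_inversion l -` (box a b))"
    by (subst emeasure_distr) auto
  also have "\<dots> = (\<integral>\<^sup>+y\<in>sphere_inversion l -` (box a b). ?J y \<partial>lborel)"
    using vm by (intro emeasure_density) auto
  also have "\<dots> = (\<integral>\<^sup>+y\<in>T. ?J y \<partial>lborel)"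
    by (intro nn_integral_cong) (auto simp: T_def indicator_def)
  also have "\<dots> = emeasure lborel (box a b - {0})"
    using emeasure_sphere_inversion_open[OF l T] imT by simp
  also have "\<dots> = emeasure lborel (box a b)"
    by (intro emeasure_Diff_null_set) auto
  finally show "emeasure (distr ?D borel (sphere_inversion l)) (box a b) = ennreal (\<Prod>i\<in>Basis. (b - a) \<bullet> i)"
    using ab by (simp add: emeasure_lborel_box_eq)
qed simp

lemma nn_integral_sphere_inversion:
  fixes f :: "'a::euclidean_space \<Rightarrow> ennreal"
  assumes "0 < l" and [measurable]: "f \<in> borel_measurable borel"
  shows "(\<integral>\<^sup>+x. f x \<partial>lborel) =
    (\<integral>\<^sup>+y. ennreal ((l / norm y) ^ (2 * DIM('a))) * f (sphere_inversion l y) \<partial>lborel)"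
  by (subst lborel_eq_distr_sphere_inversion[OF assms(1)])
     (simp add: nn_integral_distr nn_integral_density)

section \<open>Riesz kernels and potentials\<close>

text \<open>
  On the dyadic annulus between radii \<open>r / 2 ^ Suc k\<close> and \<open>r / 2 ^ k\<close> the kernel is at most its
  value at the inner radius; the resulting bounds form a geometric series with ratio
  \<open>2 powr s / 2 ^ DIM('a) < 1\<close>.
\<close>

lemma nn_integral_riesz_kernel_ball_le:
  fixes s :: real
  assumes "0 < s" "s < real DIM('a::euclidean_space)"
  shows "\<exists>K\<ge>0. \<forall>(x::'a) r. 0 < r \<longrightarrow>
    (\<integral>\<^sup>+y\<in>ball x r. ennreal (norm (x - y) powr - s) \<partial>lborel) \<le> ennreal (K * r powr (real DIM('a) - s))"
proof -
  let ?n = "DIM('a)"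
  define w where "w = unit_ball_vol (real ?n)"
  define q where "q = 2 powr s / 2 ^ ?n"
  have "2 powr s < 2 powr real ?n" using assms by (intro powr_less_mono) auto
  then have q: "0 < q" "q < 1" by (auto simp: q_def powr_realpow)
  have w0: "0 \<le> w" by (simp add: w_def)
  define K where "K = w * 2 powr s * (1 / (1 - q))"
  have K0: "0 \<le> K" using q w0 by (simp add: K_def)
  have "(\<integral>\<^sup>+y\<in>ball x r. ennreal (norm (x - y) powr - s) \<partial>lborel) \<le> ennreal (K * r powr (real ?n - s))"
    if r: "0 < r" for x :: 'a and r
  proof -
    let ?c = "\<lambda>k::nat. (r / 2 ^ Suc k) powr - s"
    let ?B = "\<lambda>k::nat. ball x (r / 2 ^ k)"
    have "ennreal (norm (x - y) powr - s) * indicator (ball x r) y \<le> (\<Sum>k. ennreal (?c k) * indicator (?B k) y)" for y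
    proof (cases "y \<in> ball x r \<and> y \<noteq> x")
      case True
      then have d: "0 < norm (x - y)" "norm (x - y) < r" by (auto simp: dist_norm)
      have "\<exists>k. r / 2 ^ k \<le> norm (x - y)"
      proof -
        obtain k where "r / norm (x - y) < 2 ^ k" using real_arch_pow[of 2 "r / norm (x - y)"] by auto
        with d show ?thesis by (intro exI[of _ k]) (simp add: field_simps)
      qed
      define k where "k = (LEAST k. r / 2 ^ k \<le> norm (x - y))"
      have k: "r / 2 ^ k \<le> norm (x - y)" unfolding k_def by (rule LeastI_ex) fact
      have "k \<noteq> 0" using k d by (intro notI) simp
      then obtain j where j: "k = Suc j" by (cases k) auto
      have "\<not> r / 2 ^ j \<le> norm (x - y)" using not_less_Least[of j "\<lambda>k. r / 2 ^ k \<le> norm (x - y)"] j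
        unfolding k_def by auto
      then have yj: "y \<in> ?B j" by (simp add: dist_norm)
      have "norm (x - y) powr - s \<le> ?c j"
        using k r assms unfolding j by (intro powr_mono2') auto
      then have "ennreal (norm (x - y) powr - s) * indicator (ball x r) y \<le> ennreal (?c j) * indicator (?B j) y"
        using True yj by (simp add: ennreal_leI)
      also have "\<dots> \<le> (\<Sum>k. ennreal (?c k) * indicator (?B k) y)"
      proof -
        have "sum h {j} \<le> suminf h" for h :: "nat \<Rightarrow> ennreal"
          by (rule sum_le_suminf) auto
        from this[of "\<lambda>k. ennreal (?c k) * indicator (?B k) y"] show ?thesis
          by (simp only: sum.insert sum.empty finite.emptyI empty_iff not_False_eq_True add_0_right)
      qed
      finally show ?thesis .
    next
      case False
      then show ?thesis by auto
    qed
    then have "(\<integral>\<^sup>+y\<in>ball x r. ennreal (norm (x - y) powr - s) \<partial>lborel)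
        \<le> (\<integral>\<^sup>+y. (\<Sum>k. ennreal (?c k) * indicator (?B k) y) \<partial>lborel)"
      by (rule nn_integral_mono)
    also have "\<dots> = (\<Sum>k. \<integral>\<^sup>+y. ennreal (?c k) * indicator (?B k) y \<partial>lborel)"
      by (intro nn_integral_suminf borel_measurable_times_ennreal borel_measurable_const
          borel_measurable_indicator) simp
    also have "\<dots> = (\<Sum>k. ennreal (w * 2 powr s * r powr (real ?n - s) * q ^ k))"
    proof (intro suminf_cong)
      fix k :: nat
      have "?c k * (r / 2 ^ k) ^ ?n = 2 powr s * r powr (real ?n - s) * q ^ k"
      proof -
        have "?c k = r powr - s * (2 ^ Suc k) powr s"
          using r by (simp add: powr_divide powr_minus divide_simps)
        moreover have "((2::real) ^ Suc k) powr s = 2 powr s * (2 powr s) ^ k"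
          by (simp add: powr_mult powr_power mult.commute)
             (metis powr_powr powr_realpow zero_less_numeral mult.commute)
        moreover have "r powr (real ?n - s) = r ^ ?n * r powr - s"
          using r by (simp add: powr_diff powr_realpow powr_minus_divide)
        ultimately show ?thesis
          by (simp add: q_def power_divide power_mult_distrib) (simp add: power_mult[symmetric] mult.commute)
      qed
      note c = this
      have "(\<integral>\<^sup>+y. ennreal (?c k) * indicator (?B k) y \<partial>lborel) = ennreal (?c k) * emeasure lborel (?B k)"
        by (rule nn_integral_cmult_indicator) simp
      also have "emeasure lborel (?B k) = ennreal (w * (r / 2 ^ k) ^ ?n)"
        unfolding w_def using r by (intro emeasure_ball) simp
      also have "ennreal (?c k) * ennreal (w * (r / 2 ^ k) ^ ?n) = ennreal (w * (?c k * (r / 2 ^ k) ^ ?n))"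
        using r w0 by (subst ennreal_mult[symmetric]) (auto simp: mult_ac)
      also have "w * (?c k * (r / 2 ^ k) ^ ?n) = w * 2 powr s * r powr (real ?n - s) * q ^ k"
        unfolding c by simp
      finally show "(\<integral>\<^sup>+y. ennreal (?c k) * indicator (?B k) y \<partial>lborel)
          = ennreal (w * 2 powr s * r powr (real ?n - s) * q ^ k)" .
    qed
    also have "\<dots> = ennreal (\<Sum>k. w * 2 powr s * r powr (real ?n - s) * q ^ k)"
      using q w0 by (intro suminf_ennreal2) (auto intro!: summable_mult summable_geometric)
    also have "(\<Sum>k. w * 2 powr s * r powr (real ?n - s) * q ^ k) = K * r powr (real ?n - s)"
      using q by (subst suminf_mult) (auto simp: suminf_geometric K_def summable_geometric)
    finally show ?thesis .
  qed
  with K0 show ?thesis by blast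
qed

text \<open>
  Uniform absolute continuity of the Riesz kernel: near the pole the previous bound applies, and at
  distance at least \<open>r\<close> from it the kernel is bounded by \<open>r powr - s\<close>.
\<close>

lemma nn_integral_riesz_kernel_small:
  fixes s e :: real
  assumes s: "0 < s" "s < real DIM('a::euclidean_space)" and e: "0 < e"
  shows "\<exists>d>0. \<forall>E. E \<in> sets borel \<longrightarrow> emeasure lborel E \<le> ennreal d \<longrightarrow>
    (\<forall>x::'a. (\<integral>\<^sup>+y\<in>E. ennreal (norm (x - y) powr - s) \<partial>lborel) \<le> ennreal e)"
proof -
  obtain K where K: "K \<ge> 0" "\<And>(x::'a) r. 0 < r \<Longrightarrow>
    (\<integral>\<^sup>+y\<in>ball x r. ennreal (norm (x - y) powr - s) \<partial>lborel) \<le> ennreal (K * r powr (real DIM('a) - s))"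
    using nn_integral_riesz_kernel_ball_le[OF s] by blast
  obtain r where r: "r > 0" "K * r powr (real DIM('a) - s) \<le> e / 2"
  proof
    show "(e / (2 * (K + 1))) powr (1 / (real DIM('a) - s)) > 0" using e K by simp
    show "K * ((e / (2 * (K + 1))) powr (1 / (real DIM('a) - s))) powr (real DIM('a) - s) \<le> e / 2"
      using e K s by (simp add: powr_powr field_simps)
  qed
  have "(\<integral>\<^sup>+y\<in>E. ennreal (norm (x - y) powr - s) \<partial>lborel) \<le> ennreal e"
    if E[measurable]: "E \<in> sets borel" and small: "emeasure lborel E \<le> ennreal (e / 2 * r powr s)" for E and x :: 'a
  proof -
    have [measurable]: "ball x r \<in> sets borel" by simp
    have "(\<integral>\<^sup>+y\<in>E. ennreal (norm (x - y) powr - s) \<partial>lborel) \<le>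
      (\<integral>\<^sup>+y. ennreal (norm (x - y) powr - s) * indicator (ball x r) y + ennreal (r powr - s) * indicator E y \<partial>lborel)"
    proof (rule nn_integral_mono)
      fix y
      have "norm (x - y) powr - s \<le> r powr - s" if "y \<notin> ball x r"
        using that r s by (intro powr_mono2') (auto simp: dist_norm)
      then show "ennreal (norm (x - y) powr - s) * indicator E y \<le>
         ennreal (norm (x - y) powr - s) * indicator (ball x r) y + ennreal (r powr - s) * indicator E y"
        by (auto simp: indicator_def intro!: ennreal_leI)
    qed
    also have "\<dots> = (\<integral>\<^sup>+y\<in>ball x r. ennreal (norm (x - y) powr - s) \<partial>lborel) + ennreal (r powr - s) * emeasure lborel E"
      by (subst nn_integral_add) (simp_all add: nn_integral_cmult_indicator)
    also have "\<dots> \<le> ennreal (e / 2) + ennreal (r powr - s) * ennreal (e / 2 * r powr s)"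
      using K(2)[OF r(1), of x] r(2) small
      by (intro add_mono mult_left_mono) (auto elim!: order_trans intro!: ennreal_leI)
    also have "\<dots> = ennreal e"
      using e r by (simp add: ennreal_mult[symmetric] ennreal_plus[symmetric] powr_minus field_simps del: ennreal_plus)
    finally show ?thesis .
  qed
  moreover have "0 < e / 2 * r powr s" using e r by simp
  ultimately show ?thesis by blast
qed

text \<open>
  For \<open>x\<close> and \<open>x'\<close> at distance less than \<open>d\<close>, the kernels with poles \<open>x\<close> and \<open>x'\<close> differ by at most
  the factor \<open>(1 + dist x x' / d) powr s\<close> outside the ball of radius \<open>d\<close> around \<open>x\<close>. Inside this
  ball the density is bounded, so its contribution is small with \<open>d\<close>. The bound on the density is
  required only almost everywhere, since in the application the density is a Borel modification
  of a Lebesgue measurable function.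
\<close>

lemma isCont_riesz_potential:
  fixes f U :: "'a::euclidean_space \<Rightarrow> real"
  assumes s: "0 < s" "s < real DIM('a)"
    and f[measurable]: "f \<in> borel_measurable borel" and f0: "\<And>y. 0 \<le> f y"
    and r: "0 < r" and bdd: "AE y in lborel. y \<in> ball a r \<longrightarrow> f y \<le> M"
    and U: "\<And>x. x \<in> ball a r \<Longrightarrow> 0 \<le> U x"
      "\<And>x. x \<in> ball a r \<Longrightarrow> (\<integral>\<^sup>+y. ennreal (norm (x - y) powr - s * f y) \<partial>lborel) = ennreal (U x)"
  shows "isCont U a"
proof -
  have M: "AE y in lborel. y \<in> ball a r \<longrightarrow> f y \<le> max M 0" using bdd by eventually_elim auto
  have compare_values: "U x \<le> (1 + dist x x' / d) powr s * U x' + e"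
    if e: "0 < e" and d: "0 < d" "ball x d \<subseteq> ball a r" "dist x x' < d" "x' \<in> ball a r"
      and K: "(\<integral>\<^sup>+y\<in>ball x d. ennreal (norm (x - y) powr - s) \<partial>lborel) * ennreal (max M 0) \<le> ennreal e"
    for x x' d e
  proof -
    have x: "x \<in> ball a r" using d by (meson centre_in_ball subsetD)
    let ?c = "(1 + dist x x' / d) powr s"
    have "ennreal (U x) \<le> (\<integral>\<^sup>+y. ennreal ?c * ennreal (norm (x' - y) powr - s * f y)
        + ennreal (norm (x - y) powr - s) * indicator (ball x d) y * ennreal (max M 0) \<partial>lborel)"
      unfolding U(2)[OF x, symmetric]
    proof (rule nn_integral_mono_AE, use M in eventually_elim)
      fix y assume y: "y \<in> ball a r \<longrightarrow> f y \<le> max M 0"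
      show "ennreal (norm (x - y) powr - s * f y) \<le> ennreal ?c * ennreal (norm (x' - y) powr - s * f y)
        + ennreal (norm (x - y) powr - s) * indicator (ball x d) y * ennreal (max M 0)"
      proof (cases "y \<in> ball x d")
        case True
        then have "f y \<le> max M 0" using y d by blast
        then have "ennreal (norm (x - y) powr - s * f y) \<le> ennreal (norm (x - y) powr - s) * ennreal (max M 0)"
          by (subst ennreal_mult[symmetric]) (auto intro!: ennreal_leI mult_left_mono)
        with True show ?thesis by (simp add: add_increasing)
      next
        case False
        then have yd: "d \<le> norm (x - y)" by (simp add: dist_norm)
        then have "dist x x' < norm (x - y)" using d by linarith
        then have y0: "0 < norm (x' - y)" by (auto simp: dist_norm)
        have "norm (x' - y) \<le> norm (x - y) + dist x x'"
          using norm_triangle_ineq[of "x' - x" "x - y"] by (simp add: dist_norm norm_minus_commute)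
        also have "\<dots> \<le> (1 + dist x x' / d) * norm (x - y)"
          using mult_left_mono[OF yd, of "dist x x' / d"] d by (simp add: algebra_simps)
        finally have "((1 + dist x x' / d) * norm (x - y)) powr - s \<le> norm (x' - y) powr - s"
          using y0 s by (intro powr_mono2') auto
        moreover have "((1 + dist x x' / d) * norm (x - y)) powr - s = norm (x - y) powr - s / ?c"
          by (simp only: powr_mult powr_minus_divide[of "1 + _"]) simp
        moreover have "0 < 1 + dist x x' / d" using d by (simp add: add_pos_nonneg)
        then have "0 < ?c" by simp
        ultimately have "norm (x - y) powr - s \<le> ?c * norm (x' - y) powr - s"
          by (metis pos_divide_le_eq mult.commute)
        from mult_right_mono[OF this f0[of y]]
        have "norm (x - y) powr - s * f y \<le> ?c * (norm (x' - y) powr - s * f y)"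
          by (simp only: mult.assoc)
        then show ?thesis using False f0 by (simp add: ennreal_mult[symmetric] ennreal_leI)
      qed
    qed
    also have "\<dots> = ennreal ?c * ennreal (U x') + (\<integral>\<^sup>+y\<in>ball x d. ennreal (norm (x - y) powr - s) \<partial>lborel) * ennreal (max M 0)"
    proof -
      have [measurable]: "ball x d \<in> sets borel" by simp
      have 1: "(\<lambda>y. ennreal (norm (x' - y) powr - s * f y)) \<in> borel_measurable lborel" by measurable
      have 2: "(\<lambda>y. ennreal (norm (x - y) powr - s) * indicator (ball x d) y) \<in> borel_measurable lborel" by measurable
      show ?thesis
        using U(2)[OF d(4)] nn_integral_cmult[OF 1] nn_integral_multc[OF 2] 1 2
        by (subst nn_integral_add) simp_all
    qed
    also have "\<dots> \<le> ennreal ?c * ennreal (U x') + ennreal e"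
      using K by (rule add_left_mono)
    also have "\<dots> = ennreal (?c * U x' + e)"
      using U(1)[OF d(4)] e by (simp add: ennreal_mult[symmetric] ennreal_plus)
    finally show ?thesis
      using U(1)[OF d(4)] e by (subst (asm) ennreal_le_iff) (auto intro!: add_nonneg_nonneg)
  qed
  have close: "\<exists>d>0. \<forall>x. dist x a < d \<longrightarrow> U x \<le> (1 + dist x a / d) powr s * U a + e \<and>
      U a \<le> (1 + dist x a / d) powr s * U x + e" if e: "0 < e" for e
  proof -
    define e' where "e' = e / (max M 0 + 1)"
    have e': "0 < e'" using e by (simp add: e'_def)
    obtain K where K: "K \<ge> 0" "\<And>(x::'a) r. 0 < r \<Longrightarrow>
      (\<integral>\<^sup>+y\<in>ball x r. ennreal (norm (x - y) powr - s) \<partial>lborel) \<le> ennreal (K * r powr (real DIM('a) - s))"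
      using nn_integral_riesz_kernel_ball_le[OF s] by blast
    have "((\<lambda>d. K * d powr (real DIM('a) - s)) \<longlongrightarrow> K * 0 powr (real DIM('a) - s)) (at_right 0)"
      using s by (intro tendsto_mult tendsto_const tendsto_powr' tendsto_ident_at) (auto simp: eventually_at_filter)
    then have "\<forall>\<^sub>F d in at_right 0. K * d powr (real DIM('a) - s) < e'"
      using e' by (intro order_tendstoD) auto
    moreover have "\<forall>\<^sub>F d in at_right 0. d < r / 2" using r by (intro eventually_at_rightI[of 0 "r/2"]) auto
    moreover have "\<forall>\<^sub>F d in at_right 0. (0::real) < d" by (simp add: eventually_at_right_less)
    ultimately have "\<forall>\<^sub>F d in at_right 0. 0 < d \<and> d < r / 2 \<and> K * d powr (real DIM('a) - s) < e'"
      by eventually_elim auto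
    then obtain d where d: "0 < d" "d < r / 2" "K * d powr (real DIM('a) - s) < e'"
      using eventually_happens trivial_limit_at_right_real by blast
    have small: "(\<integral>\<^sup>+y\<in>ball x d. ennreal (norm (x - y) powr - s) \<partial>lborel) * ennreal (max M 0) \<le> ennreal e" for x :: 'a
    proof -
      have "(\<integral>\<^sup>+y\<in>ball x d. ennreal (norm (x - y) powr - s) \<partial>lborel) \<le> ennreal e'"
        using K(2)[OF d(1), of x] d(3) by (elim order_trans) (auto intro!: ennreal_leI)
      then have "(\<integral>\<^sup>+y\<in>ball x d. ennreal (norm (x - y) powr - s) \<partial>lborel) * ennreal (max M 0) \<le> ennreal e' * ennreal (max M 0)"
        by (rule mult_right_mono) simp
      also have "\<dots> \<le> ennreal e"
        using e e' by (subst ennreal_mult[symmetric]) (auto simp: e'_def field_simps intro!: ennreal_leI)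
      finally show ?thesis .
    qed
    have sub: "ball x d \<subseteq> ball a r" if "dist x a < d" for x
    proof
      fix y assume "y \<in> ball x d"
      then show "y \<in> ball a r" using dist_triangle[of a y x] that d by (simp add: dist_commute)
    qed
    show ?thesis
    proof (intro exI[of _ d] conjI allI impI)
      fix x assume x: "dist x a < d"
      then have xr: "x \<in> ball a r" using d by (simp add: dist_commute)
      show "U x \<le> (1 + dist x a / d) powr s * U a + e"
        using x d e r sub[OF x] small[of x] by (intro compare_values) auto
      show "U a \<le> (1 + dist x a / d) powr s * U x + e"
        using compare_values[of e d a x] x d e r sub[of a] small[of a] xr by (simp add: dist_commute)
    qed (use d in auto)
  qed
  have lim: "((\<lambda>x. (1 + dist x a / d) powr t) \<longlongrightarrow> (1 + dist a a / d) powr t) (at a)" if "0 < d" for d t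
    using that by (intro tendsto_intros) auto
  have Ua: "0 \<le> U a" using U(1)[of a] r by simp
  have "(U \<longlongrightarrow> U a) (at a)"
  proof (rule order_tendstoI)
    fix b assume b: "b < U a"
    define e where "e = (U a - b) / 2"
    have e: "0 < e" "b < U a - e" using b by (auto simp: e_def field_simps)
    obtain d where d: "d > 0" "\<And>x. dist x a < d \<Longrightarrow> U a \<le> (1 + dist x a / d) powr s * U x + e"
      using close[OF e(1)] by blast
    have "((\<lambda>x. (1 + dist x a / d) powr - s * (U a - e)) \<longlongrightarrow> (1 + dist a a / d) powr - s * (U a - e)) (at a)"
      using lim[OF d(1), of "- s"] by (intro tendsto_mult_right) 
    then have "\<forall>\<^sub>F x in at a. b < (1 + dist x a / d) powr - s * (U a - e)"
      using e by (intro order_tendstoD) auto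
    moreover have "\<forall>\<^sub>F x in at a. dist x a < d" using d(1) by (auto simp: eventually_at)
    ultimately show "\<forall>\<^sub>F x in at a. b < U x"
    proof eventually_elim
      case (elim x)
      have "0 < 1 + dist x a / d" using d(1) by (simp add: add_pos_nonneg)
      then have "0 < (1 + dist x a / d) powr s" by auto
      then have "(1 + dist x a / d) powr - s * (U a - e) \<le> U x"
        using d(2)[OF elim(2)] by (simp add: powr_minus field_simps)
      with elim show ?case by simp
    qed
  next
    fix b assume b: "U a < b"
    define e where "e = (b - U a) / 2"
    have e: "0 < e" "U a + e < b" using b by (auto simp: e_def field_simps)
    obtain d where d: "d > 0" "\<And>x. dist x a < d \<Longrightarrow> U x \<le> (1 + dist x a / d) powr s * U a + e"
      using close[OF e(1)] by blast
    have "((\<lambda>x. (1 + dist x a / d) powr s * U a + e) \<longlongrightarrow> (1 + dist a a / d) powr s * U a + e) (at a)"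
      using lim[OF d(1), of s] by (intro tendsto_add tendsto_const tendsto_mult_right)
    then have "\<forall>\<^sub>F x in at a. (1 + dist x a / d) powr s * U a + e < b"
      using e by (intro order_tendstoD) auto
    moreover have "\<forall>\<^sub>F x in at a. dist x a < d" using d(1) by (auto simp: eventually_at)
    ultimately show "\<forall>\<^sub>F x in at a. U x < b"
    proof eventually_elim
      case (elim x)
      with d(2)[of x] show ?case by simp
    qed
  qed
  then show ?thesis by (simp add: isCont_def)
qed

section \<open>The Kelvin transform of a solution\<close>

text \<open>
  The kernel obtained by reflecting the second argument of the Riesz kernel in the sphere of radius
  \<open>l\<close> and multiplying by the conformal factor is \<open>reflected_dist l x y powr - s\<close>. Multiplying by
  \<open>norm y\<close> removes the pole of the inversion and makes the expression symmetric.
\<close>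

definition reflected_dist :: "real \<Rightarrow> 'a::euclidean_space \<Rightarrow> 'a \<Rightarrow> real" where
  "reflected_dist l x y = norm y * norm (x - sphere_inversion l y) / l"

lemma reflected_dist_swap:
  "x \<noteq> 0 \<Longrightarrow> y \<noteq> 0 \<Longrightarrow> reflected_dist l x y = norm x * norm (sphere_inversion l x - y) / l"
  by (simp add: reflected_dist_def norm_sphere_inversion_diff_swap)

text \<open>
  The difference of the squares is \<open>(l\<^sup>2 - (norm x)\<^sup>2) * (l\<^sup>2 - (norm y)\<^sup>2) / l\<^sup>2\<close>.
\<close>

lemma dist_less_reflected_dist:
  fixes x y :: "'a::euclidean_space"
  assumes "norm x < l" "norm y < l" "y \<noteq> 0"
  shows "norm (x - y) < reflected_dist l x y"
proof -
  have l: "0 < l" using assms(1) norm_ge_zero[of x] by linarith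
  have "0 < (l\<^sup>2 - (norm x)\<^sup>2) * (l\<^sup>2 - (norm y)\<^sup>2)"
    using assms by (intro mult_pos_pos) (auto intro!: power_strict_mono)
  also have "\<dots> = (norm y * norm (x - sphere_inversion l y))\<^sup>2 - (l * norm (x - y))\<^sup>2"
  proof -
    have nd: "(norm (x - y))\<^sup>2 = (norm x)\<^sup>2 - 2 * (x \<bullet> y) + (norm y)\<^sup>2"
      by (simp add: power2_norm_eq_inner inner_diff_left inner_diff_right inner_commute)
    show ?thesis
      unfolding norm_sphere_inversion_diff_sq[OF assms(3)] power_mult_distrib[of l] nd
      by (simp add: algebra_simps power2_eq_square power4_eq_xxxx)
  qed
  finally have "(l * norm (x - y))\<^sup>2 < (norm y * norm (x - sphere_inversion l y))\<^sup>2" by simp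
  then have "l * norm (x - y) < norm y * norm (x - sphere_inversion l y)"
    by (rule power2_less_imp_less) simp
  then show ?thesis using l by (simp add: reflected_dist_def field_simps)
qed

lemma borel_measurable_reflected_dist [measurable]:
  "reflected_dist l (x::'a::euclidean_space) \<in> borel_measurable borel"
  unfolding reflected_dist_def by measurable

lemma powr_diff_le:
  fixes a b p :: real
  assumes "0 < b" "b \<le> a" "1 \<le> p"
  shows "a powr p - b powr p \<le> p * a powr (p - 1) * (a - b)"
proof (cases "b = a")
  case False
  with assms have ba: "b < a" by simp
  have "\<exists>c. b < c \<and> c < a \<and> a powr p - b powr p = (a - b) * (p * c powr (p - 1))"
    using assms by (intro MVT2[OF ba]) (auto intro!: has_real_derivative_powr)
  then obtain c where c: "b < c" "c < a" "a powr p - b powr p = (a - b) * (p * c powr (p - 1))" by blast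
  have "c powr (p - 1) \<le> a powr (p - 1)" using c assms by (intro powr_mono2) auto
  then have "(a - b) * (p * c powr (p - 1)) \<le> (a - b) * (p * a powr (p - 1))"
    using assms by (intro mult_left_mono) auto
  with c show ?thesis by (simp add: mult_ac)
qed simp

text \<open>
  The regularised form of the problem: \<open>u\<close> has an arbitrary positive value at \<open>z\<close>, the integral runs
  over the whole space, and \<open>u\<close> is continuous off \<open>z\<close>. The condition on \<open>p\<close> is what makes the
  equation invariant under Kelvin transforms.
\<close>

locale punctured_solution =
  fixes u :: "'a::euclidean_space \<Rightarrow> real" and z :: 'a and s p :: real
  assumes s_pos: "0 < s" and s_less: "s < real DIM('a)"
    and exponent: "s * p = 2 * real DIM('a) - s"
    and u_borel [measurable]: "u \<in> borel_measurable borel"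
    and u_pos: "\<And>x. 0 < u x"
    and u_cont: "\<And>x. x \<noteq> z \<Longrightarrow> isCont u x"
    and u_eq: "\<And>x. x \<noteq> z \<Longrightarrow>
      (\<integral>\<^sup>+y. ennreal (norm (x - y) powr - s * u y powr p) \<partial>lborel) = ennreal (u x)"
    and u_unbounded: "\<And>r M. 0 < r \<Longrightarrow> \<exists>x. x \<noteq> z \<and> dist x z < r \<and> M < u x"
begin

lemma p_gt_1: "1 < p"
proof -
  have "s * 1 < s * p" using s_less exponent by simp
  then show ?thesis using s_pos by simp
qed

definition kelvin :: "real \<Rightarrow> 'a \<Rightarrow> real" where
  "kelvin l y = (l / norm y) powr s * u (sphere_inversion l y)"

lemma kelvin_borel [measurable]: "kelvin l \<in> borel_measurable borel"
  unfolding kelvin_def by measurable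

lemma kelvin_nonneg: "0 \<le> kelvin l y"
  using u_pos by (simp add: kelvin_def less_imp_le)

lemma kelvin_pos: "0 < l \<Longrightarrow> y \<noteq> 0 \<Longrightarrow> 0 < kelvin l y"
  using u_pos by (simp add: kelvin_def)

text \<open>
  The part of the integral over the exterior of the ball is moved into the ball by inversion. The
  Jacobian is \<open>(l / norm y) powr (s + s * p)\<close>: one factor \<open>(l / norm y) powr s\<close> completes the
  reflected kernel, and the remaining power turns \<open>u\<close> into its Kelvin transform.
\<close>

lemma u_split_inside_ball:
  assumes l: "0 < l" and x: "x \<noteq> z"
  shows "ennreal (u x) = (\<integral>\<^sup>+y\<in>ball 0 l. ennreal (norm (x - y) powr - s * u y powr p
           + reflected_dist l x y powr - s * kelvin l y powr p) \<partial>lborel)"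
proof -
  let ?B = "ball (0::'a) l" and ?O = "- cball (0::'a) l"
  have [measurable]: "?B \<in> sets borel" "?O \<in> sets borel" by auto
  define g where "g = (\<lambda>y. ennreal (norm (x - y) powr - s * u y powr p))"
  have [measurable]: "g \<in> borel_measurable borel" unfolding g_def by measurable
  have "sphere 0 l \<in> null_sets lborel"
    by (simp add: negligible_sphere negligible_iff_null_sets[symmetric] null_sets_completion_iff[symmetric])
  then have sph: "AE y in lborel. y \<notin> sphere (0::'a) l" by (rule AE_not_in)
  have "ennreal (u x) = (\<integral>\<^sup>+y. g y \<partial>lborel)" using u_eq[OF x] by (simp add: g_def)
  also have "\<dots> = (\<integral>\<^sup>+y. g y * indicator ?B y + g y * indicator ?O y \<partial>lborel)"
    by (rule nn_integral_cong_AE, use sph in eventually_elim) (auto simp: indicator_def)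
  also have "\<dots> = (\<integral>\<^sup>+y\<in>?B. g y \<partial>lborel) + (\<integral>\<^sup>+y\<in>?O. g y \<partial>lborel)"
    by (rule nn_integral_add) measurable
  also have "(\<integral>\<^sup>+y\<in>?O. g y \<partial>lborel) = (\<integral>\<^sup>+y. ennreal ((l / norm y) ^ (2 * DIM('a))) *
      (g (sphere_inversion l y) * indicator ?O (sphere_inversion l y)) \<partial>lborel)"
    by (rule nn_integral_sphere_inversion[OF l]) measurable
  also have "\<dots> = (\<integral>\<^sup>+y\<in>?B. ennreal (reflected_dist l x y powr - s * kelvin l y powr p) \<partial>lborel)"
  proof (rule nn_integral_cong)
    fix y :: 'a
    show "ennreal ((l / norm y) ^ (2 * DIM('a))) * (g (sphere_inversion l y) * indicator ?O (sphere_inversion l y))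
       = ennreal (reflected_dist l x y powr - s * kelvin l y powr p) * indicator ?B y"
    proof (cases "y = 0")
      case True then show ?thesis by (simp add: reflected_dist_def power_0_left)
    next
      case False
      have "sphere_inversion l y \<in> ?O \<longleftrightarrow> y \<in> ?B"
        using l False by (auto simp: norm_sphere_inversion field_simps power2_eq_square)
      moreover have "(l / norm y) ^ (2 * DIM('a)) * (norm (x - sphere_inversion l y) powr - s * u (sphere_inversion l y) powr p)
          = reflected_dist l x y powr - s * kelvin l y powr p"
      proof -
        have t: "0 < l / norm y" using l False by simp
        have "(l / norm y) ^ (2 * DIM('a)) = (l / norm y) powr (s + s * p)"
          using t unfolding exponent by (subst powr_realpow[symmetric]) auto
        also have "\<dots> = (l / norm y) powr s * ((l / norm y) powr s) powr p"
          by (simp add: powr_add powr_powr)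
        also have "(l / norm y) powr s * ((l / norm y) powr s) powr p = (norm y / l) powr - s * ((l / norm y) powr s) powr p"
          using l False by (simp add: powr_minus powr_divide)
        finally have J: "(l / norm y) ^ (2 * DIM('a)) = (norm y / l) powr - s * ((l / norm y) powr s) powr p" .
        have d: "reflected_dist l x y = norm y / l * norm (x - sphere_inversion l y)"
          by (simp add: reflected_dist_def)
        show ?thesis unfolding J d kelvin_def powr_mult by (simp only: mult_ac)
      qed
      ultimately show ?thesis
        by (auto simp: g_def indicator_def ennreal_mult[symmetric] simp del: mem_ball mem_cball ComplI)
    qed
  qed
  also have "(\<integral>\<^sup>+y\<in>?B. g y \<partial>lborel) + (\<integral>\<^sup>+y\<in>?B. ennreal (reflected_dist l x y powr - s * kelvin l y powr p) \<partial>lborel)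
      = (\<integral>\<^sup>+y\<in>?B. ennreal (norm (x - y) powr - s * u y powr p + reflected_dist l x y powr - s * kelvin l y powr p) \<partial>lborel)"
    unfolding g_def by (subst nn_integral_add[symmetric]) (auto simp: distrib_right[symmetric] intro!: nn_integral_cong)
  finally show ?thesis .
qed

text \<open>
  The previous identity at the inverse point of \<open>x\<close>, multiplied by the conformal factor, which
  exchanges the Riesz kernel with its reflection.
\<close>

lemma kelvin_split_inside_ball:
  assumes l: "0 < l" and x: "x \<noteq> 0" "x \<noteq> sphere_inversion l z"
  shows "ennreal (kelvin l x) = (\<integral>\<^sup>+y\<in>ball 0 l. ennreal (reflected_dist l x y powr - s * u y powr p
           + norm (x - y) powr - s * kelvin l y powr p) \<partial>lborel)"
proof -
  have [measurable]: "ball (0::'a) l \<in> sets borel" by simp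
  let ?x = "sphere_inversion l x" and ?c = "(l / norm x) powr s"
  have "?x \<noteq> z" using x l by (metis sphere_inversion_involution)
  from u_split_inside_ball[OF l this]
  have "ennreal (kelvin l x) = ennreal ?c * (\<integral>\<^sup>+y\<in>ball 0 l. ennreal (norm (?x - y) powr - s * u y powr p
           + reflected_dist l ?x y powr - s * kelvin l y powr p) \<partial>lborel)"
    unfolding kelvin_def[of l x] using u_pos[of ?x] by (simp add: ennreal_mult)
  also have "\<dots> = (\<integral>\<^sup>+y. ennreal ?c * (ennreal (norm (?x - y) powr - s * u y powr p
           + reflected_dist l ?x y powr - s * kelvin l y powr p) * indicator (ball 0 l) y) \<partial>lborel)"
    by (rule nn_integral_cmult[symmetric]) measurable
  also have "\<dots> = (\<integral>\<^sup>+y\<in>ball 0 l. ennreal (reflected_dist l x y powr - s * u y powr p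
           + norm (x - y) powr - s * kelvin l y powr p) \<partial>lborel)"
  proof (rule nn_integral_cong_AE, use AE_lborel_singleton[of 0] in eventually_elim)
    fix y :: 'a assume y: "y \<noteq> 0"
    have c: "?c = (norm x / l) powr - s"
      using l x by (simp add: powr_minus powr_divide)
    have 1: "?c * norm (?x - y) powr - s = reflected_dist l x y powr - s"
      unfolding reflected_dist_swap[OF x(1) y] c
      by (subst powr_mult[symmetric]) (simp add: mult.commute)
    have "reflected_dist l ?x y * (norm x / l) = norm x * norm y * norm (?x - sphere_inversion l y) / l\<^sup>2"
      by (simp add: reflected_dist_def power2_eq_square mult_ac)
    also have "\<dots> = norm (x - y)"
      unfolding norm_diff_sphere_inversions[OF x(1) y l] using l by simp
    finally have 2: "?c * reflected_dist l ?x y powr - s = norm (x - y) powr - s"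
      unfolding c by (subst powr_mult[symmetric]) (simp add: mult.commute)
    have "?c * (norm (?x - y) powr - s * u y powr p + reflected_dist l ?x y powr - s * kelvin l y powr p)
       = reflected_dist l x y powr - s * u y powr p + norm (x - y) powr - s * kelvin l y powr p"
      unfolding 1[symmetric] 2[symmetric] by (simp add: algebra_simps)
    then show "ennreal ?c * (ennreal (norm (?x - y) powr - s * u y powr p
           + reflected_dist l ?x y powr - s * kelvin l y powr p) * indicator (ball 0 l) y)
       = ennreal (reflected_dist l x y powr - s * u y powr p
           + norm (x - y) powr - s * kelvin l y powr p) * indicator (ball 0 l) y"
      by (simp only: mult.assoc[symmetric] ennreal_mult'[OF powr_ge_zero, symmetric])
  qed
  finally show ?thesis .
qed

text \<open>
  The difference of the two splittings. Each of the four terms has a finite integral, so subtraction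
  is legitimate. The transform satisfies no equation at \<open>0\<close>, the image of infinity, nor at
  \<open>sphere_inversion l z\<close>, the image of the singularity.
\<close>

lemma kelvin_difference:
  assumes l: "0 < l" "l < norm z" and x: "x \<in> ball 0 l" "x \<noteq> 0" "x \<noteq> sphere_inversion l z"
  defines "D \<equiv> \<lambda>y. indicator (ball 0 l) y * ((norm (x - y) powr - s - reflected_dist l x y powr - s)
                  * (u y powr p - kelvin l y powr p))"
  shows "integrable lborel D" "u x - kelvin l x = (LINT y|lborel. D y)"
proof -
  let ?i = "indicator (ball (0::'a) l) :: 'a \<Rightarrow> real"
  have [measurable]: "ball (0::'a) l \<in> sets borel" by simp
  have xz: "x \<noteq> z" using x l by auto
  define Fu where "Fu = (\<lambda>y. ?i y * (norm (x - y) powr - s * u y powr p))"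
  define Gu where "Gu = (\<lambda>y. ?i y * (reflected_dist l x y powr - s * u y powr p))"
  define Fk where "Fk = (\<lambda>y. ?i y * (norm (x - y) powr - s * kelvin l y powr p))"
  define Gk where "Gk = (\<lambda>y. ?i y * (reflected_dist l x y powr - s * kelvin l y powr p))"
  have nn: "0 \<le> Fu y" "0 \<le> Gu y" "0 \<le> Fk y" "0 \<le> Gk y" for y
    by (auto simp: Fu_def Gu_def Fk_def Gk_def)
  have [measurable]: "Fu \<in> borel_measurable borel" "Gu \<in> borel_measurable borel"
    "Fk \<in> borel_measurable borel" "Gk \<in> borel_measurable borel"
    unfolding Fu_def Gu_def Fk_def Gk_def by measurable
  have 1: "(\<integral>\<^sup>+y. ennreal (Fu y + Gk y) \<partial>lborel) = ennreal (u x)"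
    unfolding u_split_inside_ball[OF l(1) xz]
    by (intro nn_integral_cong) (auto simp: Fu_def Gk_def indicator_def)
  have 2: "(\<integral>\<^sup>+y. ennreal (Gu y + Fk y) \<partial>lborel) = ennreal (kelvin l x)"
    unfolding kelvin_split_inside_ball[OF l(1) x(2,3)]
    by (intro nn_integral_cong) (auto simp: Gu_def Fk_def indicator_def)
  have h1: "has_bochner_integral lborel (\<lambda>y. Fu y + Gk y) (u x)"
    using 1 nn u_pos[of x] by (intro has_bochner_integral_nn_integral) (auto simp: less_imp_le)
  have h2: "has_bochner_integral lborel (\<lambda>y. Gu y + Fk y) (kelvin l x)"
    using 2 nn kelvin_nonneg[of l x] by (intro has_bochner_integral_nn_integral) auto
  have "integrable lborel Fu" "integrable lborel Gk"
    using has_bochner_integral_integrable h1 nn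
    by (auto intro!: Bochner_Integration.integrable_bound[of lborel "\<lambda>y. Fu y + Gk y"]
        simp: has_bochner_integral_iff)
  moreover have "integrable lborel Gu" "integrable lborel Fk"
    using has_bochner_integral_integrable h2 nn
    by (auto intro!: Bochner_Integration.integrable_bound[of lborel "\<lambda>y. Gu y + Fk y"]
        simp: has_bochner_integral_iff)
  moreover have D: "D = (\<lambda>y. (Fu y + Gk y) - (Gu y + Fk y))"
    by (auto simp: D_def Fu_def Gu_def Fk_def Gk_def algebra_simps)
  ultimately show "integrable lborel D" by auto
  show "u x - kelvin l x = (LINT y|lborel. D y)"
    using has_bochner_integral_diff[OF h1 h2] unfolding D by (simp add: has_bochner_integral_iff)
qed

lemma u_bounded_cball:
  assumes "r < norm z"
  shows "\<exists>M>0. \<forall>y\<in>cball 0 r. u y \<le> M"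
proof -
  have "continuous_on (cball 0 r) u"
    using assms u_cont by (intro continuous_at_imp_continuous_on ballI) force
  then have "bounded (u ` cball 0 r)"
    by (intro compact_imp_bounded compact_continuous_image) auto
  then obtain M where "M > 0" "\<forall>y\<in>cball 0 r. norm (u y) \<le> M"
    by (auto simp: bounded_pos)
  then show ?thesis by (intro exI[of _ M]) fastforce
qed

text \<open>
  The moving spheres inequality for the radius \<open>l\<close>. The transform is not controlled at \<open>0\<close>, the image
  of infinity, and at \<open>sphere_inversion l z\<close>, the image of the singularity.
\<close>

definition dominated :: "real \<Rightarrow> bool" where
  "dominated l \<longleftrightarrow> (\<forall>x\<in>ball 0 l. x \<noteq> 0 \<longrightarrow> x \<noteq> sphere_inversion l z \<longrightarrow> u x \<le> kelvin l x)"

text \<open>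
  Let \<open>N\<close> be the supremum of \<open>u - v\<close> on the ball, \<open>v\<close> being the transform. Only points with \<open>u > v\<close>
  contribute positively to the integral for \<open>u - v\<close>, and there \<open>u\<^sup>p - v\<^sup>p\<close> is at most
  \<open>p * M powr (p - 1) * N\<close> for a bound \<open>M\<close> of \<open>u\<close>. If the set of these points is so small that the
  kernel integrates over it to at most \<open>1 / (2 * p * M powr (p - 1))\<close>, then \<open>N \<le> N / 2\<close>. The constant
  \<open>d\<close> is uniform over all radii up to \<open>r\<close>, which lets it be fixed before the critical radius is
  exceeded.
\<close>

lemma dominated_if_small_bad_set:
  assumes r: "0 < r" "r < norm z"
  shows "\<exists>d>0. \<forall>l. 0 < l \<longrightarrow> l \<le> r \<longrightarrow>
     emeasure lborel {y \<in> ball 0 l. kelvin l y < u y} \<le> ennreal d \<longrightarrow> dominated l"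
proof -
  obtain M where M: "M > 0" "\<And>y. norm y \<le> r \<Longrightarrow> u y \<le> M"
    using u_bounded_cball[OF r(2)] by auto
  define c where "c = p * M powr (p - 1)"
  have c: "0 < c" using p_gt_1 M by (simp add: c_def)
  obtain d where d: "d > 0" and small: "\<And>E x. E \<in> sets borel \<Longrightarrow> emeasure lborel E \<le> ennreal d \<Longrightarrow>
    (\<integral>\<^sup>+y\<in>E. ennreal (norm ((x::'a) - y) powr - s) \<partial>lborel) \<le> ennreal (1 / (2 * c))"
    using nn_integral_riesz_kernel_small[OF s_pos s_less, of "1 / (2 * c)"] c by auto
  have "dominated l" if l: "0 < l" "l \<le> r"
    and E: "emeasure lborel {y \<in> ball 0 l. kelvin l y < u y} \<le> ennreal d" for l
  proof (rule ccontr)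
    let ?E = "{y \<in> ball 0 l. kelvin l y < u y}"
    have [measurable]: "ball (0::'a) l \<in> sets borel" by simp
    have Em[measurable]: "?E \<in> sets borel" by measurable
    define P where "P = ball 0 l - {0, sphere_inversion l z}"
    define N where "N = (SUP x\<in>P. u x - kelvin l x)"
    assume "\<not> dominated l"
    then obtain x0 where x0: "x0 \<in> P" "0 < u x0 - kelvin l x0"
      by (auto simp: dominated_def P_def not_le)
    have "u x - kelvin l x \<le> M" if "x \<in> P" for x
      using M(2)[of x] that kelvin_nonneg[of l x] l by (simp add: P_def)
    then have bdd: "bdd_above ((\<lambda>x. u x - kelvin l x) ` P)" by (auto intro!: bdd_aboveI)
    then have leN: "u x - kelvin l x \<le> N" if "x \<in> P" for x
      unfolding N_def using that by (intro cSUP_upper)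
    then have N: "0 < N" using x0 by fastforce
    have half: "u x - kelvin l x \<le> N / 2" if x: "x \<in> P" for x
    proof -
      let ?D = "\<lambda>y. indicator (ball 0 l) y * ((norm (x - y) powr - s - reflected_dist l x y powr - s)
                  * (u y powr p - kelvin l y powr p))"
      let ?F = "\<lambda>y. norm (x - y) powr - s * indicator ?E y"
      have lz: "l < norm z" using l r by simp
      have x': "x \<in> ball 0 l" "x \<noteq> 0" "x \<noteq> sphere_inversion l z" using x by (auto simp: P_def)
      have Fle: "(\<integral>\<^sup>+y. ennreal (?F y) \<partial>lborel) \<le> ennreal (1 / (2 * c))"
        using small[OF Em E, of x] by (simp add: ennreal_mult ennreal_indicator)
      have Fint: "integrable lborel ?F"
        using Fle by (intro integrableI_bounded) (auto simp: le_less_trans)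
      have "ennreal (LINT y|lborel. ?F y) \<le> ennreal (1 / (2 * c))"
        using Fle Fint by (subst nn_integral_eq_integral[symmetric]) auto
      then have Fle': "(LINT y|lborel. ?F y) \<le> 1 / (2 * c)" using c by simp
      have "u x - kelvin l x = (LINT y|lborel. ?D y)"
        by (rule kelvin_difference(2)[OF l(1) lz x'])
      also have "\<dots> \<le> (LINT y|lborel. c * N * ?F y)"
      proof (rule integral_mono_AE)
        show "integrable lborel ?D" by (rule kelvin_difference(1)[OF l(1) lz x'])
        show "integrable lborel (\<lambda>y. c * N * ?F y)" using Fint by simp
        show "AE y in lborel. ?D y \<le> c * N * ?F y"
          using AE_lborel_singleton[of 0] AE_lborel_singleton[of "sphere_inversion l z"] AE_lborel_singleton[of x]
        proof eventually_elim
          fix y assume y: "y \<noteq> 0" "y \<noteq> sphere_inversion l z" "y \<noteq> x"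
          show "?D y \<le> c * N * ?F y"
          proof (cases "y \<in> ball 0 l")
            case False then show ?thesis using c N by simp
          next
            case True
            have dl: "norm (x - y) < reflected_dist l x y"
              using x' True y by (intro dist_less_reflected_dist) auto
            have k: "reflected_dist l x y powr - s \<le> norm (x - y) powr - s"
              using dl y s_pos by (intro powr_mono2') auto
            show ?thesis
            proof (cases "kelvin l y < u y")
              case False
              then have "u y powr p \<le> kelvin l y powr p"
                using u_pos[of y] p_gt_1 by (intro powr_mono2) auto
              then have "?D y \<le> 0" using k True by (simp add: mult_nonneg_nonpos)
              then show ?thesis using False by simp
            next
              case kl: True
              have "u y powr p - kelvin l y powr p \<le> p * u y powr (p - 1) * (u y - kelvin l y)"
                using kelvin_pos[OF l(1) y(1)] kl p_gt_1 by (intro powr_diff_le) auto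
              also have "\<dots> \<le> c * N"
                unfolding c_def using True l y kl M p_gt_1 u_pos[of y] leN[of y]
                by (intro mult_mono powr_mono2) (auto simp: P_def)
              finally have "?D y \<le> (norm (x - y) powr - s - reflected_dist l x y powr - s) * (c * N)"
                using k True by (auto intro!: mult_left_mono)
              also have "\<dots> \<le> norm (x - y) powr - s * (c * N)"
                using c N by (intro mult_right_mono) auto
              finally show ?thesis using kl True by (simp add: mult_ac)
            qed
          qed
        qed
      qed
      also have "\<dots> = c * N * (LINT y|lborel. ?F y)" by simp
      also have "\<dots> \<le> c * N * (1 / (2 * c))" using Fle' c N by (intro mult_left_mono) auto
      also have "\<dots> = N / 2" using c by simp
      finally show ?thesis .
    qed
    have "N \<le> N / 2" unfolding N_def using half x0(1) by (intro cSUP_least) (auto simp: N_def)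
    with N show False by simp
  qed
  with d show ?thesis by blast
qed

lemma isCont_kelvin:
  assumes l: "0 < l" and y: "y \<noteq> 0" "y \<noteq> sphere_inversion l z"
  shows "isCont (kelvin l) y"
proof -
  have "isCont (sphere_inversion l) y"
    using continuous_on_sphere_inversion[of l, where 'a = 'a] y(1)
    by (simp add: continuous_on_eq_continuous_at open_Compl)
  moreover have "sphere_inversion l y \<noteq> z" using y l by (metis sphere_inversion_involution)
  ultimately have "isCont (\<lambda>y. u (sphere_inversion l y)) y"
    using isCont_o2 u_cont by blast
  moreover have "isCont (\<lambda>y. (l / norm y) powr s) y"
    using l y(1) by (intro continuous_intros) auto
  ultimately show ?thesis
    unfolding kelvin_def[abs_def] by (rule isCont_mult[rotated])
qed

text \<open>
  Equality at one point makes the integral of a nonnegative function with positive kernel vanish, so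
  \<open>u\<close> coincides almost everywhere in the ball with its transform. This is impossible: \<open>u\<close> is bounded
  there, and the transform takes arbitrarily large values near \<open>sphere_inversion l z\<close>, on sets
  of positive measure by continuity.
\<close>

lemma dominated_imp_strict:
  assumes l: "0 < l" "l < norm z" and dom: "dominated l"
    and x: "x \<in> ball 0 l" "x \<noteq> 0" "x \<noteq> sphere_inversion l z"
  shows "u x < kelvin l x"
proof (rule ccontr)
  assume "\<not> u x < kelvin l x"
  with dom x have eq: "u x = kelvin l x" by (force simp: dominated_def)
  let ?D = "\<lambda>y. indicator (ball 0 l) y * ((norm (x - y) powr - s - reflected_dist l x y powr - s)
                  * (u y powr p - kelvin l y powr p))"
  note ae3 = AE_lborel_singleton[of 0] AE_lborel_singleton[of "sphere_inversion l z"] AE_lborel_singleton[of x]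
  have k: "reflected_dist l x y powr - s < norm (x - y) powr - s" if "y \<in> ball 0 l" "y \<noteq> 0" "y \<noteq> x" for y
    using dist_less_reflected_dist[of x l y] x that s_pos by (intro powr_less_mono2_neg) auto
  have D0: "AE y in lborel. 0 \<le> - ?D y"
    using ae3
  proof eventually_elim
    fix y assume y: "y \<noteq> 0" "y \<noteq> sphere_inversion l z" "y \<noteq> x"
    show "0 \<le> - ?D y"
    proof (cases "y \<in> ball 0 l")
      case True
      then have "u y \<le> kelvin l y" using dom y by (auto simp: dominated_def)
      then have "u y powr p \<le> kelvin l y powr p"
        using u_pos[of y] p_gt_1 by (intro powr_mono2) auto
      with k[OF True y(1,3)] True show ?thesis by (simp add: mult_nonneg_nonpos)
    qed simp
  qed
  have "AE y in lborel. - ?D y = 0"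
    using kelvin_difference[OF l x] eq D0 by (subst integral_nonneg_eq_0_iff_AE[symmetric]) auto
  then have same: "AE y in lborel. y \<in> ball 0 l \<longrightarrow> u y = kelvin l y"
    using ae3
  proof eventually_elim
    fix y assume D: "- ?D y = 0" and y: "y \<noteq> 0" "y \<noteq> sphere_inversion l z" "y \<noteq> x"
    show "y \<in> ball 0 l \<longrightarrow> u y = kelvin l y"
    proof
      assume yl: "y \<in> ball 0 l"
      then have "u y powr p = kelvin l y powr p" using D k[OF yl y(1,3)] by simp
      then have "(u y powr p) powr (1 / p) = (kelvin l y powr p) powr (1 / p)" by simp
      then show "u y = kelvin l y"
        using p_gt_1 u_pos[of y] kelvin_pos[OF l(1) y(1)] by (simp add: powr_powr)
    qed
  qed
  obtain M where M: "\<And>y. norm y \<le> l \<Longrightarrow> u y \<le> M" using u_bounded_cball[OF l(2)] by (metis mem_cball_0)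
  obtain x1 where x1: "x1 \<noteq> z" "dist x1 z < norm z - l" "max M 0 < u x1"
    using u_unbounded[of "norm z - l" "max M 0"] l by auto
  have nx1: "l < norm x1" using x1(2) norm_triangle_ineq2[of z x1] by (simp add: dist_norm norm_minus_commute)
  define y1 where "y1 = sphere_inversion l x1"
  have y1: "y1 \<noteq> 0" "y1 \<noteq> sphere_inversion l z" "y1 \<in> ball 0 l"
  proof -
    have x10: "x1 \<noteq> 0" using nx1 l by auto
    then show "y1 \<noteq> 0" using l by (simp add: y1_def)
    show "y1 \<noteq> sphere_inversion l z" using x1(1) l unfolding y1_def by (metis sphere_inversion_involution)
    show "y1 \<in> ball 0 l" using nx1 l x10
      by (simp add: y1_def norm_sphere_inversion field_simps power2_eq_square)
  qed
  have "kelvin l y1 = (norm x1 / l) powr s * u x1"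
    using l nx1 by (simp add: kelvin_def y1_def norm_sphere_inversion power2_eq_square)
  moreover have "1 \<le> (norm x1 / l) powr s" using nx1 l s_pos by (intro ge_one_powr_ge_zero) auto
  then have "1 * u x1 \<le> (norm x1 / l) powr s * u x1" using u_pos[of x1] by (intro mult_right_mono) auto
  moreover have "u y1 \<le> M" using M[of y1] y1(3) by simp
  ultimately have "u y1 < kelvin l y1" using x1(3) by linarith
  moreover have y1z: "y1 \<noteq> z" using y1(3) l by auto
  have "isCont (\<lambda>y. kelvin l y - u y) y1"
    using isCont_kelvin[OF l(1) y1(1,2)] u_cont[OF y1z] by (rule continuous_diff)
  ultimately have "\<forall>\<^sub>F y in at y1. 0 < kelvin l y - u y"
    by (intro order_tendstoD) (auto simp: isCont_def)
  then obtain r where r: "r > 0" "\<And>y. y \<noteq> y1 \<Longrightarrow> dist y y1 < r \<Longrightarrow> u y < kelvin l y"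
    by (auto simp: eventually_at)
  let ?W = "ball y1 r \<inter> ball 0 l"
  have "AE y in lborel. y \<notin> ?W"
    using same AE_lborel_singleton[of y1] by eventually_elim (use r(2) in \<open>force simp: dist_commute\<close>)
  then have "?W \<in> null_sets lborel" by (subst AE_iff_null_sets) auto
  then have "negligible ?W" by (simp add: negligible_iff_null_sets null_sets_completionI)
  moreover have "?W \<noteq> {}" using y1(3) r(1) by (metis IntI centre_in_ball empty_iff)
  ultimately show False using open_not_negligible[of ?W] by blast
qed

end

section \<open>Moving spheres\<close>

context punctured_solution
begin

lemma isCont_kelvin_radius:
  assumes L: "0 < L" and x: "x \<noteq> 0" "x \<noteq> sphere_inversion L z"
  shows "isCont (\<lambda>l. kelvin l x) L"
proof -
  have "isCont (\<lambda>l. sphere_inversion l x) L"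
    unfolding sphere_inversion_def using x by (intro continuous_intros) auto
  moreover have "sphere_inversion L x \<noteq> z" using x L by (metis sphere_inversion_involution)
  ultimately have "isCont (\<lambda>l. u (sphere_inversion l x)) L"
    using isCont_o2 u_cont by blast
  moreover have "isCont (\<lambda>l. (l / norm x) powr s) L"
    using L x(1) by (intro continuous_intros) auto
  ultimately show ?thesis
    unfolding kelvin_def by (rule isCont_mult[rotated])
qed

lemma dominated_small_radius:
  assumes "z \<noteq> 0"
  shows "\<exists>l0>0. \<forall>l. 0 < l \<longrightarrow> l \<le> l0 \<longrightarrow> dominated l"
proof -
  have z: "0 < norm z" using assms by simp
  obtain d where d: "d > 0" and dom: "\<And>l. 0 < l \<Longrightarrow> l \<le> norm z / 2 \<Longrightarrow>
     emeasure lborel {y \<in> ball 0 l. kelvin l y < u y} \<le> ennreal d \<Longrightarrow> dominated l"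
    using dominated_if_small_bad_set[of "norm z / 2"] z by auto
  define w where "w = unit_ball_vol (real DIM('a))"
  have w: "0 < w" by (simp add: w_def)
  \<comment> \<open>The radius is kept below 1 so that l ^ DIM('a) is at most l.\<close>
  define l0 where "l0 = min (norm z / 2) (min 1 (d / w))"
  have "dominated l" if l: "0 < l" "l \<le> l0" for l
  proof (rule dom)
    have "{y \<in> ball 0 l. kelvin l y < u y} \<subseteq> ball (0::'a) l" by auto
    then have "emeasure lborel {y \<in> ball 0 l. kelvin l y < u y} \<le> emeasure lborel (ball (0::'a) l)"
      by (rule emeasure_mono) simp
    also have "\<dots> = ennreal (w * l ^ DIM('a))" using l unfolding w_def by (intro emeasure_ball) simp
    also have "\<dots> \<le> ennreal d"
    proof (rule ennreal_leI)
      have "l ^ DIM('a) \<le> l ^ 1" using l by (intro power_decreasing) (auto simp: l0_def Suc_leI)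
      also have "l ^ 1 \<le> d / w" using l by (simp add: l0_def)
      finally show "w * l ^ DIM('a) \<le> d" using w by (simp add: field_simps)
    qed
    finally show "emeasure lborel {y \<in> ball 0 l. kelvin l y < u y} \<le> ennreal d" .
  qed (use l in \<open>auto simp: l0_def\<close>)
  moreover have "0 < l0" using z d w by (simp add: l0_def)
  ultimately show ?thesis by blast
qed

text \<open>
  The inequality is closed under increasing limits of the radius, since a point of the open ball of
  radius \<open>L\<close> lies in all slightly smaller balls and the transform depends continuously on the radius.
\<close>

lemma dominated_left_limit:
  assumes "z \<noteq> 0" and l0: "0 < l0" "l0 \<le> L" and below: "\<And>l. 0 < l \<Longrightarrow> l < L \<Longrightarrow> dominated l"
  shows "dominated L"
  unfolding dominated_def
proof (intro ballI impI)
  fix x assume x: "x \<in> ball 0 L" "x \<noteq> 0" "x \<noteq> sphere_inversion L z"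
  have L: "0 < L" using l0 by simp
  have "((\<lambda>l. sphere_inversion l z) \<longlongrightarrow> sphere_inversion L z) (at_left L)"
    unfolding sphere_inversion_def using \<open>z \<noteq> 0\<close> by (intro tendsto_intros) auto
  then have "\<forall>\<^sub>F l in at_left L. sphere_inversion l z \<noteq> x"
    using x(3) by (intro tendsto_imp_eventually_ne) auto
  moreover have "\<forall>\<^sub>F l in at_left L. norm x < l \<and> l < L"
    using x(1) by (intro eventually_at_leftI[of "norm x"]) auto
  ultimately have "\<forall>\<^sub>F l in at_left L. u x \<le> kelvin l x"
  proof eventually_elim
    case (elim l)
    then have "0 < l" using norm_ge_zero[of x] by linarith
    then have "dominated l" using below elim by simp
    with elim x(2) show ?case by (auto simp: dominated_def)
  qed
  moreover have "((\<lambda>l. kelvin l x) \<longlongrightarrow> kelvin L x) (at_left L)"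
    using isCont_kelvin_radius[OF L x(2,3)] unfolding isCont_def
    by (rule filterlim_mono) (auto simp: at_le)
  ultimately show "u x \<le> kelvin L x"
    by (intro tendsto_lowerbound[where f = "\<lambda>l. kelvin l x"]) auto
qed

text \<open>
  Almost every point leaves the set eventually: inside the ball of radius \<open>L\<close> by strictness of the
  inequality at \<open>L\<close>, outside its closure because the balls shrink to radius \<open>L\<close>.
\<close>

lemma bad_set_vanishes:
  assumes L: "0 < L" "L < norm z" and dom: "dominated L"
    and l: "\<And>k. L \<le> l k" "\<And>k. l k < norm z" "l \<longlonglongrightarrow> L"
  shows "(\<lambda>k. emeasure lborel {y \<in> ball 0 (l k). kelvin (l k) y < u y}) \<longlonglongrightarrow> 0"
proof -
  let ?E = "\<lambda>k. {y \<in> ball 0 (l k). kelvin (l k) y < u y}"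
  have [measurable]: "ball (0::'a) r \<in> sets borel" for r by simp
  have Em[measurable]: "?E k \<in> sets borel" for k by measurable
  have "sphere 0 L \<in> null_sets lborel"
    by (simp add: negligible_sphere negligible_iff_null_sets[symmetric] null_sets_completion_iff[symmetric])
  then have sph: "AE y in lborel. y \<notin> sphere (0::'a) L" by (rule AE_not_in)
  have "(\<lambda>k. \<integral>\<^sup>+y. indicator (?E k) y \<partial>lborel) \<longlonglongrightarrow> (\<integral>\<^sup>+(y::'a). 0 \<partial>lborel)"
  proof (rule nn_integral_dominated_convergence[where w = "indicator (ball (0::'a) (norm z))"])
    show "AE y in lborel. (indicator (?E k) y :: ennreal) \<le> indicator (ball 0 (norm z)) y" for k
      using l(2)[of k] by (intro AE_I2) (auto simp: indicator_def)
    show "(\<integral>\<^sup>+y. indicator (ball (0::'a) (norm z)) y \<partial>lborel) < \<infinity>"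
      using emeasure_lborel_ball_finite[of "0::'a" "norm z"] by simp
    show "AE y in lborel. (\<lambda>k. indicator (?E k) y :: ennreal) \<longlonglongrightarrow> 0"
      using sph AE_lborel_singleton[of 0] AE_lborel_singleton[of "sphere_inversion L z"]
    proof eventually_elim
      fix y :: 'a assume y: "y \<notin> sphere 0 L" "y \<noteq> 0" "y \<noteq> sphere_inversion L z"
      have "\<forall>\<^sub>F k in sequentially. y \<notin> ?E k"
      proof (cases "norm y < L")
        case True
        then have "u y < kelvin L y" using dominated_imp_strict[OF L dom, of y] y by simp
        moreover have "(\<lambda>k. kelvin (l k) y) \<longlonglongrightarrow> kelvin L y"
          using isCont_tendsto_compose[OF isCont_kelvin_radius[OF L(1) y(2,3)] l(3)] .
        ultimately have "\<forall>\<^sub>F k in sequentially. u y < kelvin (l k) y"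
          by (intro order_tendstoD)
        then show ?thesis by eventually_elim auto
      next
        case False
        then have "L < norm y" using y(1) by simp
        then have "\<forall>\<^sub>F k in sequentially. l k < norm y"
          using l(3) by (intro order_tendstoD)
        then show ?thesis by eventually_elim auto
      qed
      then have "\<forall>\<^sub>F k in sequentially. (indicator (?E k) y :: ennreal) = 0"
        by eventually_elim (simp add: indicator_def)
      then show "(\<lambda>k. indicator (?E k) y :: ennreal) \<longlonglongrightarrow> 0" by (rule tendsto_eventually)
    qed
  qed simp_all
  then show ?thesis by simp
qed

text \<open>
  A bad radius would make the infimum \<open>L\<close> of all bad radii positive and itself good. Bad radii
  decreasing to \<open>L\<close> then have sets \<open>u > v\<close> of vanishing measure, which makes them good.
\<close>

lemma dominated_all_radii:
  assumes l: "0 < l" "l < norm z"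
  shows "dominated l"
proof (rule ccontr)
  assume nd: "\<not> dominated l"
  define Bad where "Bad = {l. 0 < l \<and> l < norm z \<and> \<not> dominated l}"
  define L where "L = Inf Bad"
  have ne: "Bad \<noteq> {}" using nd l by (auto simp: Bad_def)
  obtain l0 where l0: "l0 > 0" "\<And>l. 0 < l \<Longrightarrow> l \<le> l0 \<Longrightarrow> dominated l"
    using dominated_small_radius l by (metis norm_zero order_less_asym)
  have bdd: "bdd_below Bad" by (rule bdd_belowI[of _ 0]) (auto simp: Bad_def)
  have L0: "l0 \<le> L" unfolding L_def using l0 by (intro cInf_greatest ne) (force simp: Bad_def)
  have "L \<le> l" unfolding L_def using nd l by (intro cInf_lower bdd) (auto simp: Bad_def)
  with l L0 l0 have L: "0 < L" "L < norm z" by auto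
  have below: "dominated m" if "0 < m" "m < L" for m
    using that cInf_lower[OF _ bdd, of m] L unfolding L_def Bad_def by (force simp: not_less)
  have domL: "dominated L" using dominated_left_limit[OF _ l0(1) L0 below] l by force
  have "\<exists>m\<in>Bad. m < L + 1 / real (Suc k)" for k
    unfolding L_def using cInf_lessD[OF ne, of "Inf Bad + 1 / real (Suc k)"] by auto
  then obtain m where m: "\<And>k. m k \<in> Bad" "\<And>k. m k < L + 1 / real (Suc k)" by metis
  have Lm: "L \<le> m k" for k unfolding L_def using m(1) by (intro cInf_lower bdd)
  have lim: "m \<longlonglongrightarrow> L"
  proof (rule tendsto_sandwich[OF _ _ tendsto_const])
    show "(\<lambda>k. L + 1 / real (Suc k)) \<longlonglongrightarrow> L"
      using tendsto_add[OF tendsto_const LIMSEQ_inverse_real_of_nat, of L] by (simp add: inverse_eq_divide)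
  qed (use Lm m(2) in \<open>auto simp: less_imp_le\<close>)
  define r where "r = (L + norm z) / 2"
  have r: "0 < r" "r < norm z" "L < r" using L by (auto simp: r_def)
  obtain d where d: "d > 0" "\<And>l. 0 < l \<Longrightarrow> l \<le> r \<Longrightarrow>
     emeasure lborel {y \<in> ball 0 l. kelvin l y < u y} \<le> ennreal d \<Longrightarrow> dominated l"
    using dominated_if_small_bad_set[OF r(1,2)] by auto
  have "(\<lambda>k. emeasure lborel {y \<in> ball 0 (m k). kelvin (m k) y < u y}) \<longlonglongrightarrow> 0"
    using m(1) by (intro bad_set_vanishes[OF L domL Lm _ lim]) (auto simp: Bad_def)
  then have "\<forall>\<^sub>F k in sequentially. emeasure lborel {y \<in> ball 0 (m k). kelvin (m k) y < u y} < ennreal d"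
    using d(1) by (intro order_tendstoD) auto
  moreover have "\<forall>\<^sub>F k in sequentially. m k < r" using lim r(3) by (intro order_tendstoD)
  ultimately have "\<forall>\<^sub>F k in sequentially. False"
  proof eventually_elim
    case (elim k)
    then have "dominated (m k)" using m(1)[of k] by (intro d(2)) (auto simp: Bad_def)
    then show ?case using m(1)[of k] by (simp add: Bad_def)
  qed
  then show False by simp
qed

lemma punctured_solution_translate: "punctured_solution (\<lambda>x. u (a + x)) (z - a) s p"
proof
  show "0 < s" "s < real DIM('a)" "s * p = 2 * real DIM('a) - s"
    using s_pos s_less exponent by auto
  show "(\<lambda>x. u (a + x)) \<in> borel_measurable borel" by measurable
  show "0 < u (a + x)" for x by (rule u_pos)
  show "isCont (\<lambda>x. u (a + x)) x" if "x \<noteq> z - a" for x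
  proof -
    have "a + x \<noteq> z" using that by (auto simp: algebra_simps)
    then have "isCont u (a + x)" by (rule u_cont)
    then show ?thesis by (intro isCont_o2[where f = "\<lambda>x. a + x" and g = u]) auto
  qed
  show "(\<integral>\<^sup>+y. ennreal (norm (x - y) powr - s * u (a + y) powr p) \<partial>lborel) = ennreal (u (a + x))"
    if "x \<noteq> z - a" for x
  proof -
    have "a + x \<noteq> z" using that by (auto simp: algebra_simps)
    from u_eq[OF this] have "ennreal (u (a + x)) =
        (\<integral>\<^sup>+y. ennreal (norm (a + x - y) powr - s * u y powr p) \<partial>distr lborel borel ((+) a))"
      by (simp add: lborel_distr_plus)
    also have "\<dots> = (\<integral>\<^sup>+y. ennreal (norm (x - y) powr - s * u (a + y) powr p) \<partial>lborel)"
      by (subst nn_integral_distr) auto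
    finally show ?thesis by simp
  qed
  show "\<exists>x. x \<noteq> z - a \<and> dist x (z - a) < r \<and> M < u (a + x)" if r: "0 < r" for r M
  proof -
    obtain x where x: "x \<noteq> z" "dist x z < r" "M < u x" using u_unbounded[OF r] by blast
    then show ?thesis by (intro exI[of _ "x - a"]) (auto simp: dist_norm algebra_simps)
  qed
qed

text \<open>
  The sphere with centre \<open>a = 2 * x - y\<close> and radius \<open>l = sqrt 2 * norm (x - y)\<close> has \<open>x\<close> and \<open>y\<close> as inverse
  points, at distances \<open>norm (x - y)\<close> and \<open>2 * norm (x - y)\<close> from the centre. The singularity lies
  outside it because \<open>(norm (z - a))\<^sup>2 - l\<^sup>2 = 2 * (norm (x - z))\<^sup>2 - (norm (y - z))\<^sup>2\<close>.
\<close>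

lemma u_le_closer_to_singularity:
  assumes y: "y \<noteq> z" "norm (y - z) < norm (x - z)"
  shows "u x \<le> 2 powr (s / 2) * u y"
proof -
  define a where "a = 2 *\<^sub>R x - y"
  define t where "t = y - x"
  define l where "l = sqrt 2 * norm t"
  interpret T: punctured_solution "\<lambda>x. u (a + x)" "z - a" s p by (rule punctured_solution_translate)
  have "t \<noteq> 0" using y by (auto simp: t_def)
  then have l0: "0 < l" by (simp add: l_def)
  have l2: "l\<^sup>2 = 2 * (norm t)\<^sup>2" by (simp add: l_def power_mult_distrib)
  have inv: "sphere_inversion l t = 2 *\<^sub>R t"
    using \<open>t \<noteq> 0\<close> by (simp add: sphere_inversion_def l2)
  have y_eq: "a + 2 *\<^sub>R t = y" by (simp add: a_def t_def scaleR_diff_right) (simp add: scaleR_2)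
  have "l\<^sup>2 < (norm (z - a))\<^sup>2"
  proof -
    have "(norm (z - a))\<^sup>2 - l\<^sup>2 = 2 * (norm (x - z))\<^sup>2 - (norm (y - z))\<^sup>2"
      unfolding l2 a_def t_def power2_norm_eq_inner
      by (simp add: inner_diff_left inner_diff_right inner_commute algebra_simps)
    moreover have "(norm (y - z))\<^sup>2 < (norm (x - z))\<^sup>2"
      using y(2) by (intro power_strict_mono) auto
    moreover have "0 \<le> (norm (y - z))\<^sup>2" by simp
    ultimately show ?thesis by linarith
  qed
  then have "l < norm (z - a)" by (rule power2_less_imp_less) simp
  then have "T.dominated l" using l0 by (intro T.dominated_all_radii)
  moreover have "t \<in> ball 0 l" using \<open>t \<noteq> 0\<close> by (simp add: l_def)
  moreover have "t \<noteq> sphere_inversion l (z - a)"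
  proof
    assume "t = sphere_inversion l (z - a)"
    then have "2 *\<^sub>R t = z - a" using l0 inv by (metis sphere_inversion_involution)
    with y(1) y_eq show False by simp
  qed
  ultimately have "u (a + t) \<le> T.kelvin l t" using \<open>t \<noteq> 0\<close> by (auto simp: T.dominated_def)
  also have "T.kelvin l t = sqrt 2 powr s * u (a + 2 *\<^sub>R t)"
    using \<open>t \<noteq> 0\<close> unfolding T.kelvin_def inv by (simp add: l_def)
  also note y_eq
  also have "sqrt 2 powr s = 2 powr (s / 2)" by (simp add: powr_half_sqrt[symmetric] powr_powr)
  finally show ?thesis by (simp add: a_def t_def algebra_simps scaleR_2)
qed

text \<open>
  On the ball of radius \<open>R = norm (x - z)\<close> around \<open>z\<close> the comparison bounds the integrand from below
  by a constant, which gives \<open>k * R powr (s / 2 * (p - 1)) * u x powr p \<le> u x\<close>.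
\<close>

lemma isolated_singularity_bound:
  "\<exists>C. \<forall>x. x \<noteq> z \<longrightarrow> u x \<le> C / norm (x - z) powr (s / 2)"
proof -
  define w where "w = unit_ball_vol (real DIM('a))"
  have w: "0 < w" by (simp add: w_def)
  define k where "k = w * 2 powr - s * (2 powr - (s / 2)) powr p"
  have k: "0 < k" using w by (simp add: k_def)
  have sp: "s / 2 * (p - 1) = real DIM('a) - s" using exponent by (simp add: field_simps)
  have p1: "0 < p - 1" using p_gt_1 by simp
  have "u x \<le> k powr - (1 / (p - 1)) / norm (x - z) powr (s / 2)" if x: "x \<noteq> z" for x
  proof -
    define R where "R = norm (x - z)"
    have R: "0 < R" using x by (simp add: R_def)
    define m where "m = (2 * R) powr - s * (2 powr - (s / 2) * u x) powr p"
    have m: "0 \<le> m" by (simp add: m_def)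
    have [measurable]: "ball z R \<in> sets borel" by simp
    have "ennreal (m * (w * R ^ DIM('a))) = ennreal m * emeasure lborel (ball z R)"
      using R m w by (subst emeasure_ball) (auto simp: w_def ennreal_mult)
    also have "\<dots> = (\<integral>\<^sup>+y. ennreal m * indicator (ball z R) y \<partial>lborel)"
      by (rule nn_integral_cmult_indicator[symmetric]) simp
    also have "\<dots> \<le> (\<integral>\<^sup>+y. ennreal (norm (x - y) powr - s * u y powr p) \<partial>lborel)"
    proof (rule nn_integral_mono_AE, use AE_lborel_singleton[of z] in eventually_elim)
      fix y assume yz: "y \<noteq> z"
      show "ennreal m * indicator (ball z R) y \<le> ennreal (norm (x - y) powr - s * u y powr p)"
      proof (cases "y \<in> ball z R")
        case True
        then have yR: "norm (y - z) < R" by (simp add: dist_norm norm_minus_commute)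
        then have "x \<noteq> y" by (auto simp: R_def)
        have "norm (x - y) \<le> norm (x - z) + norm (y - z)"
          using norm_triangle_ineq4[of "x - z" "y - z"] by simp
        then have "norm (x - y) \<le> 2 * R" using yR by (simp add: R_def)
        then have "(2 * R) powr - s \<le> norm (x - y) powr - s"
          using \<open>x \<noteq> y\<close> s_pos by (intro powr_mono2') auto
        moreover have "2 powr - (s / 2) * u x \<le> u y"
          using u_le_closer_to_singularity[OF yz] yR by (simp add: R_def powr_minus field_simps)
        then have "(2 powr - (s / 2) * u x) powr p \<le> u y powr p"
          using p_gt_1 u_pos[of x] by (intro powr_mono2) auto
        ultimately have "m \<le> norm (x - y) powr - s * u y powr p"
          unfolding m_def by (intro mult_mono) auto
        then show ?thesis using True by (simp add: ennreal_leI)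
      qed simp
    qed
    also have "\<dots> = ennreal (u x)" by (rule u_eq[OF x])
    finally have "m * (w * R ^ DIM('a)) \<le> u x"
      using u_pos[of x] by (simp add: less_imp_le)
    also have "m * (w * R ^ DIM('a)) = k * R powr (s / 2 * (p - 1)) * u x powr p"
      unfolding m_def k_def sp powr_mult using R by (simp add: powr_diff powr_realpow powr_minus_divide)
    also have "u x powr p = u x powr (p - 1) * u x" using u_pos[of x] by (simp add: powr_diff)
    finally have "k * R powr (s / 2 * (p - 1)) * u x powr (p - 1) \<le> 1" 
      using u_pos[of x] by (simp add: mult.assoc[symmetric])
    then have "k * (R powr (s / 2) * u x) powr (p - 1) \<le> 1"
      by (simp add: powr_mult powr_powr mult.assoc)
    then have "(R powr (s / 2) * u x) powr (p - 1) \<le> 1 / k" using k by (simp add: field_simps)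
    then have "((R powr (s / 2) * u x) powr (p - 1)) powr (1 / (p - 1)) \<le> (1 / k) powr (1 / (p - 1))"
      using p1 by (intro powr_mono2) auto
    moreover have "((R powr (s / 2) * u x) powr (p - 1)) powr (1 / (p - 1)) = R powr (s / 2) * u x"
      using p1 R u_pos[of x] by (simp add: powr_powr)
    moreover have "(1 / k) powr (1 / (p - 1)) = k powr - (1 / (p - 1))"
      using k by (simp add: powr_divide powr_minus_divide)
    ultimately show ?thesis using R by (simp add: R_def[symmetric] field_simps)
  qed
  then show ?thesis by blast
qed

end

section \<open>Solutions with one singularity\<close>

lemma integral_equation_lborel:
  fixes u :: "real^'n \<Rightarrow> real"
  assumes "\<alpha> < real CARD('n)" and sol: "positive_solution \<alpha> (- {xo}) u" and x: "x \<noteq> xo" "\<not> singularity (- {xo}) u x"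
    and w: "\<And>y. y \<noteq> xo \<Longrightarrow> w y = u y"
  shows "(\<integral>\<^sup>+y. ennreal (norm (x - y) powr - (real CARD('n) - \<alpha>)
      * w y powr ((real CARD('n) + \<alpha>) / (real CARD('n) - \<alpha>))) \<partial>lborel) = ennreal (u x)"
proof -
  have D: "- {xo} \<in> sets lebesgue" by simp
  have int: "integrable (lebesgue_on (- {xo})) (riesz_integrand \<alpha> u x)"
    and eq: "u x = integral\<^sup>L (lebesgue_on (- {xo})) (riesz_integrand \<alpha> u x)"
    using sol x by (auto simp: positive_solution_def)
  have "ennreal (u x) = (\<integral>\<^sup>+y. ennreal (riesz_integrand \<alpha> u x y) \<partial>lebesgue_on (- {xo}))"
    unfolding eq by (rule nn_integral_eq_integral[symmetric, OF int]) (simp add: riesz_integrand_def)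
  also have "\<dots> = (\<integral>\<^sup>+y. ennreal (riesz_integrand \<alpha> u x y) * indicator (- {xo}) y \<partial>lebesgue)"
    using D by (intro nn_integral_restrict_space) simp
  also have "\<dots> = (\<integral>\<^sup>+y. ennreal (riesz_integrand \<alpha> u x y) * indicator (- {xo}) y \<partial>lborel)"
    by (rule nn_integral_completion)
  also have "\<dots> = (\<integral>\<^sup>+y. ennreal (norm (x - y) powr - (real CARD('n) - \<alpha>)
      * w y powr ((real CARD('n) + \<alpha>) / (real CARD('n) - \<alpha>))) \<partial>lborel)"
    by (rule nn_integral_cong_AE, use AE_lborel_singleton[of xo] in eventually_elim)
       (simp add: w riesz_integrand_def powr_minus_divide[of _ "real CARD('n) - \<alpha>", simplified])
  finally show ?thesis by simp
qed

theorem theorem3: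
  fixes u :: "real^'n \<Rightarrow> real" and xo :: "real^'n" and \<alpha> :: real
  assumes "0 < \<alpha>" and "\<alpha> < real CARD('n)"
    and "positive_solution \<alpha> (- {xo}) u"
    and "only_singularity u xo"
  shows "\<exists>C::real. \<forall>x. x \<noteq> xo \<longrightarrow>
           u x \<le> C / norm (x - xo) powr ((real CARD('n) - \<alpha>) / 2)"
proof -
  define s where "s = real CARD('n) - \<alpha>"
  define p where "p = (real CARD('n) + \<alpha>) / (real CARD('n) - \<alpha>)"
  define w where "w = (\<lambda>x. if x \<in> - {xo} then u x else 1)"
  have wu: "w y = u y" if "y \<noteq> xo" for y using that by (simp add: w_def)
  have s: "0 < s" "s < real DIM(real^'n)" using assms by (auto simp: s_def)
  have p0: "0 < p" using assms by (simp add: p_def)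
  have pos: "0 < w x" for x using assms(3) by (auto simp: w_def positive_solution_def)
  have nonsing: "\<not> singularity (- {xo}) u x" if "x \<noteq> xo" for x
    using assms(4) that by (auto simp: only_singularity_def)
  have eq: "(\<integral>\<^sup>+y. ennreal (norm (x - y) powr - s * w y powr p) \<partial>lborel) = ennreal (w x)"
    if "x \<noteq> xo" for x
    using integral_equation_lborel[OF assms(2,3) that nonsing[OF that] wu] wu[OF that]
    by (simp add: s_def p_def)
  have wm: "w \<in> borel_measurable lebesgue"
  proof -
    have "(\<lambda>x. if x \<in> - {xo} then u x else 0) \<in> borel_measurable lebesgue"
      using assms(3) by (subst borel_measurable_if) (auto simp: positive_solution_def)
    moreover have "(indicator {xo} :: _ \<Rightarrow> real) \<in> borel_measurable lebesgue"
      by (intro borel_measurable_indicator) simp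
    moreover have "w = (\<lambda>x. (if x \<in> - {xo} then u x else 0) + indicator {xo} x)"
      by (auto simp: w_def)
    ultimately show ?thesis by (simp only: borel_measurable_add)
  qed
  \<comment> \<open>Continuity of u has to be derived from the equation while u is only known to be Lebesgue
    measurable, so the density is replaced by a Borel function that agrees with it almost everywhere.\<close>
  obtain g where g[measurable]: "g \<in> borel_measurable lborel" and wg: "AE x in lborel. w x = g x"
    using completion_ex_borel_measurable_real[OF wm] by blast
  have cont: "isCont w x" if x: "x \<noteq> xo" for x
  proof -
    from nonsing[OF x] obtain V where V: "open V" "x \<in> V" "bounded (u ` (V \<inter> - {xo}))"
      by (auto simp: singularity_def)
    have "open (V \<inter> - {xo})" using V by (intro open_Int) auto
    then obtain r where r: "r > 0" "ball x r \<subseteq> V \<inter> - {xo}"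
      using V x by (metis IntI ComplI singletonD openE)
    obtain M where M: "\<And>y. y \<in> V \<inter> - {xo} \<Longrightarrow> \<bar>u y\<bar> \<le> M"
      using V(3) by (auto simp: bounded_iff)
    show ?thesis
    proof (rule isCont_riesz_potential[OF s, where f = "\<lambda>y. (max (g y) 0) powr p" and r = r and M = "M powr p"])
      show "AE y in lborel. y \<in> ball x r \<longrightarrow> max (g y) 0 powr p \<le> M powr p"
        using wg
      proof eventually_elim
        case (elim y)
        show ?case
        proof
          assume "y \<in> ball x r"
          with r(2) have "y \<in> V \<inter> - {xo}" by blast
          with M[of y] elim wu[of y] pos[of y] p0 show "max (g y) 0 powr p \<le> M powr p"
            by (intro powr_mono2) auto
        qed
      qed
      show "0 \<le> w y" for y using pos[of y] by simp
      show "(\<integral>\<^sup>+y'. ennreal (norm (y - y') powr - s * max (g y') 0 powr p) \<partial>lborel) = ennreal (w y)"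
        if "y \<in> ball x r" for y
      proof -
        have "y \<noteq> xo" using that r(2) by blast
        have "(\<integral>\<^sup>+y'. ennreal (norm (y - y') powr - s * max (g y') 0 powr p) \<partial>lborel)
            = (\<integral>\<^sup>+y'. ennreal (norm (y - y') powr - s * w y' powr p) \<partial>lborel)"
        proof (rule nn_integral_cong_AE, use wg in eventually_elim)
          fix y' assume "w y' = g y'"
          then have "max (g y') 0 = w y'" using pos[of y'] by simp
          then show "ennreal (norm (y - y') powr - s * max (g y') 0 powr p)
              = ennreal (norm (y - y') powr - s * w y' powr p)" by simp
        qed
        then show ?thesis using eq[OF \<open>y \<noteq> xo\<close>] by simp
      qed
    qed (use r in auto)
  qed
  have borel: "w \<in> borel_measurable borel"
    unfolding w_def
  proof (rule borel_measurable_continuous_on_if)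
    have "continuous_on (- {xo}) w" using cont by (intro continuous_at_imp_continuous_on) auto
    then show "continuous_on (- {xo}) u" by (rule continuous_on_eq) (auto simp: wu)
  qed auto
  interpret punctured_solution w xo s p
  proof
    show "s * p = 2 * real DIM(real^'n) - s" using s by (simp add: s_def p_def)
    show "\<exists>x. x \<noteq> xo \<and> dist x xo < r \<and> M < w x" if r: "0 < r" for r M
    proof (rule ccontr)
      assume no: "\<not> ?thesis"
      have "bounded (u ` (ball xo r \<inter> - {xo}))"
      proof (rule boundedI)
        fix t assume "t \<in> u ` (ball xo r \<inter> - {xo})"
        then obtain y where "t = u y" "y \<in> ball xo r" "y \<noteq> xo" by blast
        with no wu[of y] pos[of y] show "norm t \<le> M"
          by (metis abs_of_pos dist_commute mem_ball not_le real_norm_def)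
      qed
      moreover have "singularity (- {xo}) u xo" using assms(4) by (simp add: only_singularity_def)
      ultimately show False using r by (auto simp: singularity_def)
    qed
  qed (use s pos cont eq borel in auto)
  from isolated_singularity_bound show ?thesis by (auto simp: wu s_def)
qed

end
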